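(* Let $\mu$ be a positive Borel measure on $\mathbb{C}^n$ ($n\ge 1$) such that the monomials $z^\alpha$, $\alpha\in\mathbb{N}^n$, are pairwise orthogonal in $L^2(d\mu)$ and $0<\int|z^\alpha|^2\,d\mu<\infty$ for all $\alpha\in\mathbb{N}^n$. Then the canonical solution operator $S\colon A^2_{(0,1)}(d\mu)\to L^2(d\mu)$ to $\bar\partial$ is compact if and only if $$\lim_{\gamma}\left(\frac{c_{\gamma+e_p}}{c_{\gamma+2e_p}}-\frac{c_\gamma}{c_{\gamma+e_p}}\right)=0$$ for all $p=1,\dots,n$, where for each $p$ the limit is taken over the multiindices $\gamma\in\Gamma$ with $\gamma+e_p\ge0$ (that is, for every $\varepsilon>0$ the expression has absolute value less than $\varepsilon$ for all but finitely many such $\gamma$).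
   Context: $\mathbb{N}=\{0,1,2,\dots\}$. $A^2(d\mu)$ is the closure in $L^2(d\mu)$ of the linear span of the monomials $z^\alpha$, $\alpha\in\mathbb{N}^n$, and $c_\alpha=\left(\int|z^\alpha|^2\,d\mu\right)^{-1}$ for $\alpha\in\mathbb{N}^n$. $A^2_{(0,1)}(d\mu)$ is the Hilbert space of $(0,1)$-forms $\sum_{j=1}^n f_j\,d\bar z_j$ with $f_j\in A^2(d\mu)$, with norm squared $\sum_j\|f_j\|^2_{L^2(d\mu)}$. Multiindices: $\Gamma$ is the set of $\gamma\in\mathbb{Z}^n$ with all entries $\ge -1$ and at most one entry equal to $-1$. If $\gamma$ has an entry equal to $-1$, put $c_\gamma=0$. $e_j$ is the multiindex with $1$ in position $j$ and $0$ elsewhere; $\gamma+e_p\ge0$ means all entries of $\gamma+e_p$ are nonnegative. Canonical solution operator: $S\omega$ is the solution $f\in L^2(d\mu)$ of $\bar\partial f=\omega$ that is orthogonal to $A^2(d\mu)$. Concretely, since $\bar\partial(\bar z_j z^\alpha)=z^\alpha d\bar z_j$, on the dense subspace of forms with polynomial coefficients (finite linear combinations of the $z^\alpha d\bar z_j$) $S$ is the linear map for which $S(z^\alpha d\bar z_j)$ is the unique element of $\bar z_j z^\alpha+A^2(d\mu)$ orthogonal to $A^2(d\mu)$. "$S$ is compact" means that this densely defined map extends to a compact operator $A^2_{(0,1)}(d\mu)\to L^2(d\mu)$. *)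

theory Defs
  imports "HOL-Analysis.Analysis"
begin

definition monomial :: "nat^'n \<Rightarrow> complex^'n \<Rightarrow> complex" where
  "monomial \<alpha> z = (\<Prod>i\<in>UNIV. (z $ i) ^ (\<alpha> $ i))"

text \<open>
  Elements of \<open>L\<^sup>2(d\<mu>)\<close> are represented by square-integrable functions, with no passage to
  equivalence classes; identities between elements of \<open>L\<^sup>2(d\<mu>)\<close> are therefore stated
  almost everywhere.
\<close>

definition L2 :: "(complex^'n) measure \<Rightarrow> (complex^'n \<Rightarrow> complex) set" where
  "L2 \<mu> = {f \<in> borel_measurable \<mu>. integrable \<mu> (\<lambda>z. (cmod (f z))\<^sup>2)}"

definition L2_inner ::
  "(complex^'n) measure \<Rightarrow> (complex^'n \<Rightarrow> complex) \<Rightarrow> (complex^'n \<Rightarrow> complex) \<Rightarrow> complex" where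
  "L2_inner \<mu> f g = (LINT z|\<mu>. f z * cnj (g z))"

definition L2_norm :: "(complex^'n) measure \<Rightarrow> (complex^'n \<Rightarrow> complex) \<Rightarrow> real" where
  "L2_norm \<mu> f = sqrt (LINT z|\<mu>. (cmod (f z))\<^sup>2)"

definition polynomials :: "(complex^'n \<Rightarrow> complex) set" where
  "polynomials = {\<lambda>z. \<Sum>\<alpha>\<in>F. a \<alpha> * monomial \<alpha> z | F a. finite F}"

definition A2 :: "(complex^'n) measure \<Rightarrow> (complex^'n \<Rightarrow> complex) set" where
  "A2 \<mu> = {f \<in> L2 \<mu>. \<forall>\<epsilon>>0. \<exists>p\<in>polynomials. L2_norm \<mu> (\<lambda>z. f z - p z) < \<epsilon>}"

text \<open>
  A \<open>(0,1)\<close>-form is represented by the vector of its coefficients: component \<open>j\<close> is the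
  coefficient of \<open>d\<close>-bar \<open>z\<^sub>j\<close>.
\<close>

definition A2_01 :: "(complex^'n) measure \<Rightarrow> (complex^'n \<Rightarrow> complex^'n) set" where
  "A2_01 \<mu> = {\<omega>. \<forall>j. (\<lambda>z. \<omega> z $ j) \<in> A2 \<mu>}"

definition form_norm :: "(complex^'n) measure \<Rightarrow> (complex^'n \<Rightarrow> complex^'n) \<Rightarrow> real" where
  "form_norm \<mu> \<omega> = sqrt (\<Sum>j\<in>UNIV. (L2_norm \<mu> (\<lambda>z. \<omega> z $ j))\<^sup>2)"

text \<open>
  Forms with polynomial coefficients, given by a finitely supported coefficient family:
  \<open>a \<alpha> $ j\<close> is the coefficient of \<open>z\<^sup>\<alpha>\<close> times \<open>d\<close>-bar \<open>z\<^sub>j\<close>. The family is determined by the form,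
  because a polynomial function on \<open>\<complex>\<^sup>n\<close> determines its coefficients.
\<close>

definition poly_form :: "(nat^'n \<Rightarrow> complex^'n) \<Rightarrow> complex^'n \<Rightarrow> complex^'n" where
  "poly_form a = (\<lambda>z. \<chi> j. \<Sum>\<alpha> | a \<alpha> \<noteq> 0. a \<alpha> $ j * monomial \<alpha> z)"

definition poly_forms :: "(complex^'n \<Rightarrow> complex^'n) set" where
  "poly_forms = {poly_form a | a. finite {\<alpha>. a \<alpha> \<noteq> 0}}"

definition form_coeffs :: "(complex^'n \<Rightarrow> complex^'n) \<Rightarrow> nat^'n \<Rightarrow> complex^'n" where
  "form_coeffs \<omega> = (THE a. finite {\<alpha>. a \<alpha> \<noteq> 0} \<and> poly_form a = \<omega>)"

text \<open>
  The canonical solution for the form \<open>z\<^sup>\<alpha>\<close> times \<open>d\<close>-bar \<open>z\<^sub>j\<close>: the element of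
  \<open>cnj z\<^sub>j z\<^sup>\<alpha> + A\<^sup>2(d\<mu>)\<close> orthogonal to \<open>A\<^sup>2(d\<mu>)\<close>. It is unique as an element of
  \<open>L\<^sup>2(d\<mu>)\<close>, and the choice operator selects a representative.
\<close>

definition canonical_solution_monomial ::
  "(complex^'n) measure \<Rightarrow> nat^'n \<Rightarrow> 'n \<Rightarrow> complex^'n \<Rightarrow> complex" where
  "canonical_solution_monomial \<mu> \<alpha> j =
     (SOME f. f \<in> L2 \<mu> \<and> (\<lambda>z. f z - cnj (z $ j) * monomial \<alpha> z) \<in> A2 \<mu> \<and>
              (\<forall>g\<in>A2 \<mu>. L2_inner \<mu> f g = 0))"

text \<open>The linear extension to \<^const>\<open>poly_forms\<close>; on other forms the value is irrelevant.\<close>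

definition canonical_solution ::
  "(complex^'n) measure \<Rightarrow> (complex^'n \<Rightarrow> complex^'n) \<Rightarrow> complex^'n \<Rightarrow> complex" where
  "canonical_solution \<mu> \<omega> =
     (\<lambda>z. \<Sum>\<alpha> | form_coeffs \<omega> \<alpha> \<noteq> 0. \<Sum>j\<in>UNIV.
        form_coeffs \<omega> \<alpha> $ j * canonical_solution_monomial \<mu> \<alpha> j z)"

text \<open>
  Compact linear operators from \<open>A\<^sup>2\<^sub>(\<^sub>0\<^sub>,\<^sub>1\<^sub>)(d\<mu>)\<close> to \<open>L\<^sup>2(d\<mu>)\<close>. The second condition says that
  the operator is well defined on elements of the Hilbert space, that is, on classes of forms
  modulo almost everywhere equality.
\<close>

definition compact_operator_A2_01_L2 ::
  "(complex^'n) measure \<Rightarrow> ((complex^'n \<Rightarrow> complex^'n) \<Rightarrow> complex^'n \<Rightarrow> complex) \<Rightarrow> bool" where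
  "compact_operator_A2_01_L2 \<mu> T \<longleftrightarrow>
     (\<forall>\<omega>\<in>A2_01 \<mu>. T \<omega> \<in> L2 \<mu>) \<and>
     (\<forall>\<omega>\<in>A2_01 \<mu>. \<forall>\<eta>\<in>A2_01 \<mu>.
        (AE z in \<mu>. \<omega> z = \<eta> z) \<longrightarrow> (AE z in \<mu>. T \<omega> z = T \<eta> z)) \<and>
     (\<forall>\<omega>\<in>A2_01 \<mu>. \<forall>\<eta>\<in>A2_01 \<mu>. AE z in \<mu>. T (\<lambda>w. \<omega> w + \<eta> w) z = T \<omega> z + T \<eta> z) \<and>
     (\<forall>b. \<forall>\<omega>\<in>A2_01 \<mu>. AE z in \<mu>. T (\<lambda>w. b *s \<omega> w) z = b * T \<omega> z) \<and>
     (\<forall>\<Omega> :: nat \<Rightarrow> complex^'n \<Rightarrow> complex^'n.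
        (\<forall>k. \<Omega> k \<in> A2_01 \<mu>) \<and> (\<exists>B. \<forall>k. form_norm \<mu> (\<Omega> k) \<le> B) \<longrightarrow>
        (\<exists>f\<in>L2 \<mu>. \<exists>r. strict_mono r \<and>
           (\<lambda>k. L2_norm \<mu> (\<lambda>z. T (\<Omega> (r k)) z - f z)) \<longlonglongrightarrow> 0))"

definition canonical_solution_operator_compact :: "(complex^'n) measure \<Rightarrow> bool" where
  "canonical_solution_operator_compact \<mu> \<longleftrightarrow>
     (\<exists>T. compact_operator_A2_01_L2 \<mu> T \<and>
          (\<forall>\<omega>\<in>poly_forms. AE z in \<mu>. T \<omega> z = canonical_solution \<mu> \<omega> z))"

definition c_coeff :: "(complex^'n) measure \<Rightarrow> int^'n \<Rightarrow> real" where
  "c_coeff \<mu> \<gamma> =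
     (if \<exists>i. \<gamma> $ i < 0 then 0
      else inverse (LINT z|\<mu>. (cmod (monomial (\<chi> i. nat (\<gamma> $ i)) z))\<^sup>2))"

definition multiindices :: "(int^'n) set" where
  "multiindices = {\<gamma>. (\<forall>i. \<gamma> $ i \<ge> -1) \<and> card {i. \<gamma> $ i = -1} \<le> 1}"

end

theory Submission
  imports Defs "HOL-Complex_Analysis.Great_Picard"
begin

text \<open>
  For a fixed direction \<open>p\<close> let \<open>S\<^sub>p\<close> be the operator \<open>z\<^sup>\<alpha> \<mapsto> S(z\<^sup>\<alpha> d\<close>-bar \<open>z\<^sub>p)\<close> on polynomials in one
  coefficient, so that \<open>S\<close> is the sum of the finitely many \<open>S\<^sub>p\<close> applied to the components of a form.
  Pairing \<open>cnj z\<^sub>p z\<^sup>\<alpha>\<close> with a monomial \<open>z\<^sup>\<beta>\<close> gives the inner product of \<open>z\<^sup>\<alpha>\<close> with \<open>z\<^sub>p z\<^sup>\<beta>\<close>; hence the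
  orthogonal projection of \<open>cnj z\<^sub>p z\<^sup>\<alpha>\<close> to \<open>A\<^sup>2(d\<mu>)\<close> is a multiple of the single monomial
  \<open>z\<^bsup>\<alpha> - e\<^sub>p\<^esup>\<close> (zero if \<open>\<alpha>\<^sub>p = 0\<close>), and \<open>S(z\<^sup>\<alpha> d\<close>-bar \<open>z\<^sub>p)\<close> is an explicit difference of two functions.
  From the explicit formula, the images \<open>S(z\<^sup>\<alpha> d\<close>-bar \<open>z\<^sub>p)\<close> with \<open>p\<close> fixed are pairwise orthogonal
  (\<open>solution_orthogonal\<close>), and their squared norms divided by the squared norm of \<open>z\<^sup>\<alpha>\<close> are exactly
  the expression of the theorem at \<open>\<gamma> = \<alpha> - e\<^sub>p\<close> (\<open>ratio_eq_c_coeff\<close>). So \<open>S\<^sub>p\<close> is a diagonal operator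
  from one orthogonal system to another, and the theorem says that such an operator is compact if and only if
  its diagonal tends to zero.

  If \<open>S\<close> is compact and the diagonal of some \<open>S\<^sub>p\<close> stays above \<open>\<epsilon>\<close> on an infinite set of
  multiindices, then the normalised monomials of that set form a bounded sequence of forms whose images are
  pairwise at squared distance at least \<open>2 \<epsilon>\<close>, so no subsequence of the images converges
  (\<open>canonical_solution_compact_imp_ratio\<close>).

  Conversely, if all diagonals tend to zero, then the orthogonal series
  \<open>\<Sum>\<^sub>\<alpha> a\<^sub>\<alpha>(f) S(z\<^sup>\<alpha> d\<close>-bar \<open>z\<^sub>p)\<close>, with \<open>a\<^sub>\<alpha>(f)\<close> the Fourier coefficients of \<open>f\<close>, converges in \<open>L\<^sup>2(d\<mu>)\<close> by
  Bessel's inequality and completeness (\<open>L2_complete\<close>), and extends \<open>S\<^sub>p\<close>. A bounded sequence of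
  forms has a subsequence all of whose Fourier coefficients converge. Along it the images are Cauchy: finitely
  many terms of the series converge, and the remaining ones are uniformly small since the diagonal is
  (\<open>diag_images_Cauchy\<close>). Working with the single directions \<open>S\<^sub>p\<close> and the inequality
  \<open>sqnorm_sum_le\<close> avoids the finite blocks that \<open>S\<^sup>* S\<close> has.
\<close>

section \<open>Square-integrable functions\<close>

text \<open>
  The square of the norm is the basic quantity here. It expands sesquilinearly, and
  \<open>\<bar>a + b\<bar>\<^sup>2 \<le> 2 \<bar>a\<bar>\<^sup>2 + 2 \<bar>b\<bar>\<^sup>2\<close> integrates to a quasi-triangle inequality, which serves all
  convergence arguments below in place of Minkowski's inequality.
\<close>

definition sqnorm :: "(complex^'n) measure \<Rightarrow> (complex^'n \<Rightarrow> complex) \<Rightarrow> real" where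
  "sqnorm \<mu> f = (LINT z|\<mu>. (cmod (f z))\<^sup>2)"

lemma sqnorm_nonneg [simp]: "0 \<le> sqnorm \<mu> f"
  by (simp add: sqnorm_def)

lemma L2_norm_eq_sqrt: "L2_norm \<mu> f = sqrt (sqnorm \<mu> f)"
  by (simp add: sqnorm_def L2_norm_def)

lemma L2_norm_tendsto_0_iff: "((\<lambda>k. L2_norm \<mu> (f k)) \<longlongrightarrow> 0) F \<longleftrightarrow> ((\<lambda>k. sqnorm \<mu> (f k)) \<longlongrightarrow> 0) F"
proof -
  have "((\<lambda>k. sqrt (sqnorm \<mu> (f k))) \<longlongrightarrow> 0) F \<Longrightarrow> ((\<lambda>k. (sqrt (sqnorm \<mu> (f k)))\<^sup>2) \<longlongrightarrow> 0\<^sup>2) F"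
    by (rule tendsto_power)
  moreover have "((\<lambda>k. sqnorm \<mu> (f k)) \<longlongrightarrow> 0) F \<Longrightarrow> ((\<lambda>k. sqrt (sqnorm \<mu> (f k))) \<longlongrightarrow> sqrt 0) F"
    by (rule tendsto_real_sqrt)
  ultimately show ?thesis
    by (auto simp: L2_norm_eq_sqrt)
qed

lemma L2_I: "f \<in> borel_measurable \<mu> \<Longrightarrow> integrable \<mu> (\<lambda>z. (cmod (f z))\<^sup>2) \<Longrightarrow> f \<in> L2 \<mu>"
  by (simp add: L2_def)

lemma L2_measurable [measurable_dest]: "f \<in> L2 \<mu> \<Longrightarrow> f \<in> borel_measurable \<mu>"
  by (simp add: L2_def)

lemma L2_integrable: "f \<in> L2 \<mu> \<Longrightarrow> integrable \<mu> (\<lambda>z. (cmod (f z))\<^sup>2)"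
  by (simp add: L2_def)

lemma cmod_add_sq_le: "(cmod (a + b))\<^sup>2 \<le> 2 * (cmod a)\<^sup>2 + 2 * (cmod b)\<^sup>2"
proof -
  have "(cmod (a + b))\<^sup>2 \<le> (cmod a + cmod b)\<^sup>2"
    by (simp add: norm_triangle_ineq power_mono)
  also have "\<dots> \<le> 2 * (cmod a)\<^sup>2 + 2 * (cmod b)\<^sup>2"
    using sum_squares_bound[of "cmod a" "cmod b"] by (simp add: power2_sum)
  finally show ?thesis .
qed

lemma L2_add:
  assumes "f \<in> L2 \<mu>" "g \<in> L2 \<mu>"
  shows "(\<lambda>z. f z + g z) \<in> L2 \<mu>"
proof (rule L2_I)
  show m: "(\<lambda>z. f z + g z) \<in> borel_measurable \<mu>"
    using assms by (auto intro: L2_measurable)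
  have "integrable \<mu> (\<lambda>z. 2 * (cmod (f z))\<^sup>2 + 2 * (cmod (g z))\<^sup>2)"
    by (intro Bochner_Integration.integrable_add integrable_mult_right L2_integrable assms)
  then show "integrable \<mu> (\<lambda>z. (cmod (f z + g z))\<^sup>2)"
    by (rule Bochner_Integration.integrable_bound) (use m in \<open>auto simp: cmod_add_sq_le\<close>)
qed

lemma L2_scale: "f \<in> L2 \<mu> \<Longrightarrow> (\<lambda>z. a * f z) \<in> L2 \<mu>"
  by (auto simp: L2_def norm_mult power_mult_distrib)

lemma L2_zero [simp]: "(\<lambda>z. 0) \<in> L2 \<mu>"
  by (auto simp: L2_def)

lemma L2_diff:
  assumes "f \<in> L2 \<mu>" "g \<in> L2 \<mu>"
  shows "(\<lambda>z. f z - g z) \<in> L2 \<mu>"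
  using L2_add[OF assms(1) L2_scale[OF assms(2), of "-1"]] by simp

lemma L2_sum: "(\<And>i. i \<in> F \<Longrightarrow> f i \<in> L2 \<mu>) \<Longrightarrow> (\<lambda>z. \<Sum>i\<in>F. f i z) \<in> L2 \<mu>"
  by (induction F rule: infinite_finite_induct) (auto intro: L2_add)

lemma L2_mult_integrable:
  assumes "f \<in> L2 \<mu>" "g \<in> L2 \<mu>"
  shows "integrable \<mu> (\<lambda>z. f z * cnj (g z))"
proof (rule Bochner_Integration.integrable_bound)
  show "integrable \<mu> (\<lambda>z. (cmod (f z))\<^sup>2 + (cmod (g z))\<^sup>2)"
    using assms by (auto intro: L2_integrable)
  have [measurable]: "f \<in> borel_measurable \<mu>" "g \<in> borel_measurable \<mu>"
    using assms by (auto intro: L2_measurable)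
  have [measurable]: "cnj \<in> borel_measurable borel"
    by (intro borel_measurable_continuous_onI continuous_on_cnj continuous_on_id)
  show "(\<lambda>z. f z * cnj (g z)) \<in> borel_measurable \<mu>" by measurable
  have "cmod a * cmod b \<le> (cmod a)\<^sup>2 + (cmod b)\<^sup>2" for a b
    using sum_squares_bound[of "cmod a" "cmod b"] mult_nonneg_nonneg[of "cmod a" "cmod b"]
    by (simp add: mult.assoc) (smt (verit) mult_nonneg_nonneg norm_ge_zero)
  then show "AE z in \<mu>. norm (f z * cnj (g z)) \<le> norm ((cmod (f z))\<^sup>2 + (cmod (g z))\<^sup>2)"
    by (simp add: norm_mult)
qed

lemma L2_inner_self: "L2_inner \<mu> f f = of_real (sqnorm \<mu> f)"
  unfolding L2_inner_def sqnorm_def complex_norm_square[symmetric]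
  by (rule integral_complex_of_real)

lemma L2_inner_cnj: "L2_inner \<mu> g f = cnj (L2_inner \<mu> f g)"
  unfolding L2_inner_def
  by (subst Bochner_Integration.integral_cnj[symmetric]) (simp add: mult.commute)

lemma L2_inner_add_left:
  "f \<in> L2 \<mu> \<Longrightarrow> g \<in> L2 \<mu> \<Longrightarrow> h \<in> L2 \<mu> \<Longrightarrow>
    L2_inner \<mu> (\<lambda>z. f z + g z) h = L2_inner \<mu> f h + L2_inner \<mu> g h"
  unfolding L2_inner_def distrib_right by (intro Bochner_Integration.integral_add L2_mult_integrable)

lemma L2_inner_scale_left: "L2_inner \<mu> (\<lambda>z. a * f z) h = a * L2_inner \<mu> f h"
  unfolding L2_inner_def by (simp add: mult.assoc)

lemma L2_inner_diff_left:
  "f \<in> L2 \<mu> \<Longrightarrow> g \<in> L2 \<mu> \<Longrightarrow> h \<in> L2 \<mu> \<Longrightarrow>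
    L2_inner \<mu> (\<lambda>z. f z - g z) h = L2_inner \<mu> f h - L2_inner \<mu> g h"
  unfolding L2_inner_def left_diff_distrib by (intro Bochner_Integration.integral_diff L2_mult_integrable)

lemma L2_inner_sum_left:
  "(\<And>i. i \<in> F \<Longrightarrow> f i \<in> L2 \<mu>) \<Longrightarrow> h \<in> L2 \<mu> \<Longrightarrow>
    L2_inner \<mu> (\<lambda>z. \<Sum>i\<in>F. f i z) h = (\<Sum>i\<in>F. L2_inner \<mu> (f i) h)"
  unfolding L2_inner_def sum_distrib_right by (intro Bochner_Integration.integral_sum L2_mult_integrable)

lemma L2_inner_diff_right:
  "f \<in> L2 \<mu> \<Longrightarrow> g \<in> L2 \<mu> \<Longrightarrow> h \<in> L2 \<mu> \<Longrightarrow>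
    L2_inner \<mu> h (\<lambda>z. f z - g z) = L2_inner \<mu> h f - L2_inner \<mu> h g"
  by (subst (1 2 3) L2_inner_cnj) (simp add: L2_inner_diff_left)

lemma L2_inner_scale_right: "L2_inner \<mu> h (\<lambda>z. a * f z) = cnj a * L2_inner \<mu> h f"
  by (subst (1 2) L2_inner_cnj) (simp add: L2_inner_scale_left)

lemma L2_inner_sum_right:
  "(\<And>i. i \<in> F \<Longrightarrow> f i \<in> L2 \<mu>) \<Longrightarrow> h \<in> L2 \<mu> \<Longrightarrow>
    L2_inner \<mu> h (\<lambda>z. \<Sum>i\<in>F. f i z) = (\<Sum>i\<in>F. L2_inner \<mu> h (f i))"
  by (subst (1 2) L2_inner_cnj) (simp add: L2_inner_sum_left)

lemma L2_inner_cong_AE: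
  assumes "f \<in> L2 \<mu>" "g \<in> L2 \<mu>" "h \<in> L2 \<mu>" "AE z in \<mu>. f z = g z"
  shows "L2_inner \<mu> f h = L2_inner \<mu> g h"
  unfolding L2_inner_def
  by (rule integral_cong_AE) (use assms in \<open>auto intro!: borel_measurable_integrable L2_mult_integrable\<close>)

lemma sqnorm_cong_AE:
  assumes "f \<in> L2 \<mu>" "g \<in> L2 \<mu>" "AE z in \<mu>. f z = g z"
  shows "sqnorm \<mu> f = sqnorm \<mu> g"
  unfolding sqnorm_def
  by (rule integral_cong_AE) (use assms in \<open>auto intro!: borel_measurable_integrable L2_integrable\<close>)

lemma sqnorm_scale: "sqnorm \<mu> (\<lambda>z. a * f z) = (cmod a)\<^sup>2 * sqnorm \<mu> f"
  by (simp add: sqnorm_def norm_mult power_mult_distrib)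

lemma sqnorm_minus_commute: "sqnorm \<mu> (\<lambda>z. f z - g z) = sqnorm \<mu> (\<lambda>z. g z - f z)"
  by (simp add: sqnorm_def norm_minus_commute)

lemma sqnorm_zero_AE:
  assumes "f \<in> L2 \<mu>" "sqnorm \<mu> f = 0"
  shows "AE z in \<mu>. f z = 0"
  using integral_nonneg_eq_0_iff_AE[OF L2_integrable[OF assms(1)]] assms(2)
  by (simp add: sqnorm_def)

lemma sqnorm_add_le:
  assumes "f \<in> L2 \<mu>" "g \<in> L2 \<mu>"
  shows "sqnorm \<mu> (\<lambda>z. f z + g z) \<le> 2 * sqnorm \<mu> f + 2 * sqnorm \<mu> g"
proof -
  have i: "integrable \<mu> (\<lambda>z. (cmod (f z))\<^sup>2)" "integrable \<mu> (\<lambda>z. (cmod (g z))\<^sup>2)"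
    using assms by (auto intro: L2_integrable)
  have "sqnorm \<mu> (\<lambda>z. f z + g z) \<le> (LINT z|\<mu>. 2 * (cmod (f z))\<^sup>2 + 2 * (cmod (g z))\<^sup>2)"
    unfolding sqnorm_def
    by (rule integral_mono) (use i L2_integrable[OF L2_add[OF assms]] in \<open>auto simp: cmod_add_sq_le\<close>)
  also have "\<dots> = 2 * sqnorm \<mu> f + 2 * sqnorm \<mu> g"
    using i by (simp add: sqnorm_def)
  finally show ?thesis .
qed

lemma sqnorm_diff_le_via:
  assumes "f \<in> L2 \<mu>" "g \<in> L2 \<mu>" "h \<in> L2 \<mu>"
  shows "sqnorm \<mu> (\<lambda>z. f z - h z) \<le> 2 * sqnorm \<mu> (\<lambda>z. f z - g z) + 2 * sqnorm \<mu> (\<lambda>z. g z - h z)"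
  using sqnorm_add_le[OF L2_diff[OF assms(1,2)] L2_diff[OF assms(2,3)]] by simp

text \<open>
  The pointwise inequality is Cauchy--Schwarz against the constant vector \<open>1\<close>. It bounds a sum of operators over the
  coordinate directions by the individual operators.
\<close>

lemma sqnorm_sum_le:
  assumes F: "finite F" and f: "\<And>i. i \<in> F \<Longrightarrow> f i \<in> L2 \<mu>"
  shows "sqnorm \<mu> (\<lambda>z. \<Sum>i\<in>F. f i z) \<le> real (card F) * (\<Sum>i\<in>F. sqnorm \<mu> (f i))"
proof -
  have "sqnorm \<mu> (\<lambda>z. \<Sum>i\<in>F. f i z) \<le> (LINT z|\<mu>. real (card F) * (\<Sum>i\<in>F. (cmod (f i z))\<^sup>2))"
    unfolding sqnorm_def
  proof (rule integral_mono)
    show "integrable \<mu> (\<lambda>z. (cmod (\<Sum>i\<in>F. f i z))\<^sup>2)"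
      by (intro L2_integrable L2_sum f)
    show "integrable \<mu> (\<lambda>z. real (card F) * (\<Sum>i\<in>F. (cmod (f i z))\<^sup>2))"
      by (intro integrable_mult_right Bochner_Integration.integrable_sum L2_integrable f)
  next
    fix z
    have "(cmod (\<Sum>i\<in>F. f i z))\<^sup>2 \<le> (\<Sum>i\<in>F. cmod (f i z))\<^sup>2"
      by (intro power_mono sum_norm_le) auto
    also have "\<dots> \<le> (\<Sum>i\<in>F. (cmod (f i z))\<^sup>2) * real (card F)"
      by (rule sum_squared_le_sum_of_squares)
    finally show "(cmod (\<Sum>i\<in>F. f i z))\<^sup>2 \<le> real (card F) * (\<Sum>i\<in>F. (cmod (f i z))\<^sup>2)"
      by (simp add: mult.commute)
  qed
  also have "\<dots> = real (card F) * (\<Sum>i\<in>F. sqnorm \<mu> (f i))"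
    using f by (subst integral_mult_right_zero, subst Bochner_Integration.integral_sum)
       (auto simp: sqnorm_def intro: L2_integrable)
  finally show ?thesis .
qed

lemma sqnorm_orthogonal_sum:
  assumes F: "finite F" and f: "\<And>i. i \<in> F \<Longrightarrow> f i \<in> L2 \<mu>"
    and orth: "\<And>i j. i \<in> F \<Longrightarrow> j \<in> F \<Longrightarrow> i \<noteq> j \<Longrightarrow> L2_inner \<mu> (f i) (f j) = 0"
  shows "sqnorm \<mu> (\<lambda>z. \<Sum>i\<in>F. a i * f i z) = (\<Sum>i\<in>F. (cmod (a i))\<^sup>2 * sqnorm \<mu> (f i))"
proof -
  have m: "(\<lambda>z. \<Sum>i\<in>F. a i * f i z) \<in> L2 \<mu>"
    by (intro L2_sum L2_scale f)
  have "complex_of_real (sqnorm \<mu> (\<lambda>z. \<Sum>i\<in>F. a i * f i z))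
     = (\<Sum>i\<in>F. \<Sum>j\<in>F. a i * (cnj (a j) * L2_inner \<mu> (f i) (f j)))"
    using f m by (subst L2_inner_self[symmetric])
      (simp add: L2_inner_sum_left L2_inner_sum_right L2_scale L2_inner_scale_left
        L2_inner_scale_right sum_distrib_left)
  also have "\<dots> = (\<Sum>i\<in>F. \<Sum>j\<in>F. if j = i then of_real ((cmod (a i))\<^sup>2 * sqnorm \<mu> (f i)) else 0)"
    using orth by (intro sum.cong refl)
      (auto simp: L2_inner_self complex_norm_square mult.assoc simp del: of_real_power)
  also have "\<dots> = of_real (\<Sum>i\<in>F. (cmod (a i))\<^sup>2 * sqnorm \<mu> (f i))"
    using F by (simp add: sum.delta)
  finally show ?thesis
    using of_real_eq_iff by blast
qed

text \<open>
  With \<open>p\<close> the projection of \<open>f\<close> to the span of the \<open>\<phi> i\<close>, the squared norm of \<open>f - p\<close> is the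
  difference of the two sides.
\<close>

lemma bessel:
  assumes F: "finite F" and f: "f \<in> L2 \<mu>" and \<phi>: "\<And>i. i \<in> F \<Longrightarrow> \<phi> i \<in> L2 \<mu>"
    and orth: "\<And>i j. i \<in> F \<Longrightarrow> j \<in> F \<Longrightarrow> i \<noteq> j \<Longrightarrow> L2_inner \<mu> (\<phi> i) (\<phi> j) = 0"
    and pos: "\<And>i. i \<in> F \<Longrightarrow> 0 < sqnorm \<mu> (\<phi> i)"
  shows "(\<Sum>i\<in>F. (cmod (L2_inner \<mu> f (\<phi> i)))\<^sup>2 / sqnorm \<mu> (\<phi> i)) \<le> sqnorm \<mu> f"
proof -
  define c where "c i = L2_inner \<mu> f (\<phi> i) / of_real (sqnorm \<mu> (\<phi> i))" for i
  define p where "p = (\<lambda>z. \<Sum>i\<in>F. c i * \<phi> i z)"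
  define S where "S = (\<Sum>i\<in>F. (cmod (L2_inner \<mu> f (\<phi> i)))\<^sup>2 / sqnorm \<mu> (\<phi> i))"
  have p: "p \<in> L2 \<mu>"
    unfolding p_def by (intro L2_sum L2_scale \<phi>)
  have "sqnorm \<mu> p = (\<Sum>i\<in>F. (cmod (c i))\<^sup>2 * sqnorm \<mu> (\<phi> i))"
    unfolding p_def using F \<phi> orth by (rule sqnorm_orthogonal_sum)
  also have "\<dots> = S"
    unfolding S_def c_def using pos
    by (intro sum.cong refl) (auto simp: norm_divide power_divide power2_eq_square dest: less_imp_neq)
  finally have pp: "L2_inner \<mu> p p = of_real S"
    by (simp add: L2_inner_self)
  have "L2_inner \<mu> f p = (\<Sum>i\<in>F. L2_inner \<mu> f (\<lambda>z. c i * \<phi> i z))"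
    unfolding p_def using f \<phi> by (intro L2_inner_sum_right L2_scale)
  also have "\<dots> = of_real S"
    unfolding S_def of_real_sum L2_inner_scale_right
    by (intro sum.cong refl)
       (simp add: c_def complex_norm_square mult.commute del: of_real_power)
  finally have fp: "L2_inner \<mu> f p = of_real S" .
  have pf: "L2_inner \<mu> p f = of_real S"
    using L2_inner_cnj[of \<mu> p f] fp by simp
  have "complex_of_real (sqnorm \<mu> (\<lambda>z. f z - p z)) = of_real (sqnorm \<mu> f - S)"
    using L2_inner_diff_left[OF f p L2_diff[OF f p]] L2_inner_diff_right[OF f p f]
      L2_inner_diff_right[OF f p p]
    by (simp add: L2_inner_self[symmetric] fp pf pp)
  then have "sqnorm \<mu> (\<lambda>z. f z - p z) = sqnorm \<mu> f - S"
    using of_real_eq_iff by blast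
  then show ?thesis
    using sqnorm_nonneg[of \<mu> "\<lambda>z. f z - p z"] by (simp add: S_def)
qed

text \<open>
  Bessel's inequality for the system consisting of \<open>g\<close> alone, unless \<open>g\<close> vanishes almost everywhere.
\<close>

lemma cauchy_schwarz:
  assumes "f \<in> L2 \<mu>" "g \<in> L2 \<mu>"
  shows "(cmod (L2_inner \<mu> f g))\<^sup>2 \<le> sqnorm \<mu> f * sqnorm \<mu> g"
proof (cases "sqnorm \<mu> g = 0")
  case True
  then have "AE z in \<mu>. g z = 0"
    using sqnorm_zero_AE assms by blast
  then have "L2_inner \<mu> g f = L2_inner \<mu> (\<lambda>z. 0) f"
    using assms by (intro L2_inner_cong_AE) auto
  then show ?thesis
    using True by (subst L2_inner_cnj) (simp add: L2_inner_def)
next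
  case False
  then have "0 < sqnorm \<mu> g"
    using sqnorm_nonneg[of \<mu> g] by linarith
  then show ?thesis
    using bessel[of "{()}" f \<mu> "\<lambda>_. g"] assms by (simp add: field_simps)
qed

section \<open>Completeness\<close>

text \<open>
  Let \<open>d\<^sub>k\<close> be the increments. The weighted sum \<open>W = \<Sum>\<^sub>k 2\<^sup>k \<bar>d\<^sub>k\<bar>\<^sup>2\<close> has integral at most
  \<open>\<Sum>\<^sub>k 2\<^sup>k 4\<^bsup>-k\<^esup> = 2\<close>, hence is finite almost everywhere. By Cauchy--Schwarz
  \<open>(\<Sum>\<^sub>k\<^sub>\<ge>\<^sub>N \<bar>d\<^sub>k\<bar>)\<^sup>2 \<le> (\<Sum>\<^sub>k\<^sub>\<ge>\<^sub>N 2\<^bsup>-k\<^esup>) W\<close>, so the sequence converges wherever \<open>W\<close> is finite, and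
  the same inequality, integrated, gives convergence in \<open>L\<^sup>2(d\<mu>)\<close>.
\<close>

lemma rapid_cauchy_L2_limit:
  fixes f :: "nat \<Rightarrow> complex^'n \<Rightarrow> complex"
  assumes f: "\<And>n. f n \<in> L2 \<mu>"
    and close: "\<And>k. sqnorm \<mu> (\<lambda>z. f (Suc k) z - f k z) \<le> (1/4)^k"
  shows "\<exists>g\<in>L2 \<mu>. (\<lambda>k. sqnorm \<mu> (\<lambda>z. f k z - g z)) \<longlonglongrightarrow> 0"
proof -
  define d where "d k z = f (Suc k) z - f k z" for k z
  have d: "d k \<in> L2 \<mu>" for k
    unfolding d_def by (intro L2_diff f)
  have [measurable]: "f k \<in> borel_measurable \<mu>" "d k \<in> borel_measurable \<mu>" for k
    using f d by (auto intro: L2_measurable)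
  define w where "w k z = 2^k * (cmod (d k z))\<^sup>2" for k z
  have wi: "integrable \<mu> (w k)" for k
    unfolding w_def by (intro integrable_mult_right L2_integrable d)
  have w0: "0 \<le> w k z" for k z by (simp add: w_def)
  have wint: "(LINT z|\<mu>. w k z) \<le> (1/2)^k" for k
  proof -
    have "(LINT z|\<mu>. w k z) = 2^k * sqnorm \<mu> (d k)"
      by (simp add: w_def sqnorm_def)
    also have "\<dots> \<le> 2^k * (1/4)^k"
      using close[of k] by (intro mult_left_mono) (auto simp: d_def[abs_def])
    also have "\<dots> = (1/2)^k"
      by (simp add: power_mult_distrib[symmetric])
    finally show ?thesis .
  qed
  have "(\<integral>\<^sup>+z. (\<Sum>k. ennreal (w k z)) \<partial>\<mu>) = (\<Sum>k. \<integral>\<^sup>+z. ennreal (w k z) \<partial>\<mu>)"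
    using wi by (intro nn_integral_suminf) (auto intro!: measurable_compose[OF borel_measurable_integrable])
  also have "\<dots> = (\<Sum>k. ennreal (LINT z|\<mu>. w k z))"
    using wi w0 by (intro suminf_cong nn_integral_eq_integral) auto
  also have "\<dots> \<le> (\<Sum>k. ennreal ((1/2)^k))"
    by (intro suminf_le ennreal_leI wint) auto
  also have "\<dots> < \<infinity>"
    by (subst suminf_ennreal2) (auto intro!: summable_geometric)
  finally have fin: "(\<integral>\<^sup>+z. (\<Sum>k. ennreal (w k z)) \<partial>\<mu>) < \<infinity>" .
  have AEfin: "AE z in \<mu>. summable (\<lambda>k. w k z)"
  proof -
    have "AE z in \<mu>. (\<Sum>k. ennreal (w k z)) \<noteq> \<infinity>"
      using fin wi by (intro nn_integral_PInf_AE) (auto intro!: borel_measurable_suminf measurable_compose[OF borel_measurable_integrable])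
    then show ?thesis
      by eventually_elim (use w0 summable_suminf_not_top in auto)
  qed
  have Wi: "integrable \<mu> (\<lambda>z. \<Sum>k. w k z)"
  proof (rule integrable_suminf[OF wi])
    show "AE z in \<mu>. summable (\<lambda>k. norm (w k z))"
      using AEfin by eventually_elim (simp add: w0)
    show "summable (\<lambda>k. LINT z|\<mu>. norm (w k z))"
      using wint w0 by (intro summable_comparison_test'[OF summable_geometric[of "1/2::real"], of 0]) auto
  qed
  define W where "W z = (\<Sum>k. w k z)" for z
  \<comment> \<open>where the sequence diverges, \<open>lim\<close> has an arbitrary value; this happens on a null set only\<close>
  define g where "g z = lim (\<lambda>M. f M z)" for z
  have g_meas [measurable]: "g \<in> borel_measurable \<mu>"
    unfolding g_def[abs_def] by (rule borel_measurable_lim_metric) measurable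
  have tail: "(cmod (f N z - g z))\<^sup>2 \<le> 2 * (1/2)^N * W z" if S: "summable (\<lambda>k. w k z)" for N z
  proof -
    have part: "(\<Sum>k\<in>A. cmod (d k z))\<^sup>2 \<le> (\<Sum>k\<in>A. (1/2)^k) * W z" if "finite A" for A
    proof -
      have "(\<Sum>k\<in>A. cmod (d k z))\<^sup>2 = (\<Sum>k\<in>A. sqrt ((1/2)^k) * sqrt (w k z))\<^sup>2"
        by (intro arg_cong[where f="\<lambda>x. x\<^sup>2"] sum.cong refl)
          (simp add: w_def real_sqrt_mult[symmetric] mult.assoc[symmetric] power_mult_distrib[symmetric])
      also have "\<dots> \<le> (\<Sum>k\<in>A. (sqrt ((1/2)^k))\<^sup>2) * (\<Sum>k\<in>A. (sqrt (w k z))\<^sup>2)"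
        by (rule Cauchy_Schwarz_ineq_sum)
      also have "\<dots> = (\<Sum>k\<in>A. (1/2)^k) * (\<Sum>k\<in>A. w k z)"
        by (simp add: w0)
      also have "\<dots> \<le> (\<Sum>k\<in>A. (1/2)^k) * W z"
        unfolding W_def using that S w0 by (intro mult_left_mono sum_le_suminf sum_nonneg) auto
      finally show ?thesis .
    qed
    have W0: "0 \<le> W z"
      unfolding W_def by (intro suminf_nonneg S w0)
    have geo: "(\<Sum>k\<in>{N..<M}. (1/2)^k) \<le> 2 * (1/2::real)^N" for N M
    proof (cases "N \<le> M")
      case True
      then have "(\<Sum>k\<in>{N..<M}. (1/2::real)^k) = 2 * ((1/2)^N - (1/2)^M)"
        by (induction M rule: dec_induct) (simp_all add: algebra_simps del: power_one_over power_divide)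
      also have "\<dots> \<le> 2 * (1/2)^N"
        by simp
      finally show ?thesis .
    qed simp
    have seg: "(\<Sum>k\<in>{N..<M}. cmod (d k z))\<^sup>2 \<le> 2 * (1/2)^N * W z" for N M
      using part[of "{N..<M}"] mult_right_mono[OF geo[of N M] W0] by simp
    have sumabs: "summable (\<lambda>k. cmod (d k z))"
    proof (rule summableI_nonneg_bounded)
      show "(\<Sum>k<n. cmod (d k z)) \<le> sqrt (2 * W z)" for n
        using seg[of 0 n] by (intro real_le_rsqrt) (simp add: atLeast0LessThan)
    qed auto
    then have sd: "summable (\<lambda>k. d k z)"
      by (rule summable_norm_cancel)
    have fM: "f M z = f 0 z + (\<Sum>k<M. d k z)" for M
      by (induction M) (auto simp: d_def)
    have "(\<lambda>M. (cmod (f N z - f M z))\<^sup>2) \<longlonglongrightarrow> (cmod (f N z - g z))\<^sup>2"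
    proof (intro tendsto_power tendsto_norm tendsto_diff tendsto_const)
      show "(\<lambda>M. f M z) \<longlonglongrightarrow> g z"
      proof -
        have "(\<lambda>M. f M z) \<longlonglongrightarrow> f 0 z + (\<Sum>k. d k z)"
          using tendsto_add[OF tendsto_const summable_LIMSEQ[OF sd], of "f 0 z"]
          by (simp add: fM[symmetric])
        then show ?thesis
          by (simp add: g_def limI)
      qed
    qed
    moreover have "(cmod (f N z - f M z))\<^sup>2 \<le> 2 * (1/2)^N * W z" if "N \<le> M" for M
    proof -
      have "f M z - f N z = (\<Sum>k\<in>{N..<M}. d k z)"
        using that
      proof (induction M rule: dec_induct)
        case (step M)
        have "f (Suc M) z - f N z = (f M z - f N z) + d M z"
          by (simp add: d_def)
        with step show ?case by simp
      qed simp
      then have "cmod (f N z - f M z) \<le> (\<Sum>k\<in>{N..<M}. cmod (d k z))"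
        by (metis norm_minus_commute norm_sum)
      then have "(cmod (f N z - f M z))\<^sup>2 \<le> (\<Sum>k\<in>{N..<M}. cmod (d k z))\<^sup>2"
        by (intro power_mono) auto
      with seg[of N M] show ?thesis by linarith
    qed
    ultimately show ?thesis
      by (intro LIMSEQ_le_const2) auto
  qed
  have bi: "integrable \<mu> (\<lambda>z. 2 * (1/2)^N * W z)" for N :: nat
    unfolding W_def by (intro integrable_mult_right Wi)
  have AEtail: "AE z in \<mu>. (cmod (f N z - g z))\<^sup>2 \<le> 2 * (1/2)^N * W z" for N
    using AEfin by eventually_elim (rule tail)
  have fgL2: "(\<lambda>z. f N z - g z) \<in> L2 \<mu>" for N
  proof (rule L2_I)
    show "integrable \<mu> (\<lambda>z. (cmod (f N z - g z))\<^sup>2)"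
    proof (rule Bochner_Integration.integrable_bound[OF bi[of N]])
      show "AE z in \<mu>. norm ((cmod (f N z - g z))\<^sup>2) \<le> norm (2 * (1/2)^N * W z)"
        using AEtail[of N]
      proof eventually_elim
        case (elim z)
        then have "(cmod (f N z - g z))\<^sup>2 \<le> \<bar>2 * (1/2)^N * W z\<bar>"
          by (rule order_trans) (rule abs_ge_self)
        then show ?case by simp
      qed
    qed measurable
  qed measurable
  have gL2: "g \<in> L2 \<mu>"
    using L2_diff[OF f[of 0] fgL2[of 0]] by simp
  have bound: "sqnorm \<mu> (\<lambda>z. f N z - g z) \<le> 2 * (1/2)^N * (LINT z|\<mu>. W z)" for N
  proof -
    have "sqnorm \<mu> (\<lambda>z. f N z - g z) \<le> (LINT z|\<mu>. 2 * (1/2)^N * W z)"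
      unfolding sqnorm_def by (intro integral_mono_AE L2_integrable fgL2 bi AEtail)
    then show ?thesis by simp
  qed
  have "(\<lambda>N. 2 * (1/2)^N * (LINT z|\<mu>. W z)) \<longlonglongrightarrow> 2 * 0 * (LINT z|\<mu>. W z)"
    by (intro tendsto_intros) auto
  then have lim: "(\<lambda>N. 2 * (1/2)^N * (LINT z|\<mu>. W z)) \<longlonglongrightarrow> 0"
    by simp
  have "(\<lambda>k. sqnorm \<mu> (\<lambda>z. f k z - g z)) \<longlonglongrightarrow> 0"
    by (rule tendsto_sandwich[OF _ _ tendsto_const lim]) (intro always_eventually allI sqnorm_nonneg bound)+
  with gL2 show ?thesis by blast
qed

text \<open>
  Riesz--Fischer: a Cauchy sequence has a subsequence with the rapid decay of \<open>rapid_cauchy_L2_limit\<close>, and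
  converges to the limit of that subsequence.
\<close>

theorem L2_complete:
  fixes f :: "nat \<Rightarrow> complex^'n \<Rightarrow> complex"
  assumes f: "\<And>n. f n \<in> L2 \<mu>"
    and cauchy: "\<And>\<epsilon>. 0 < \<epsilon> \<Longrightarrow> \<exists>M. \<forall>m\<ge>M. \<forall>n\<ge>M. sqnorm \<mu> (\<lambda>z. f m z - f n z) < \<epsilon>"
  shows "\<exists>g\<in>L2 \<mu>. (\<lambda>k. sqnorm \<mu> (\<lambda>z. f k z - g z)) \<longlonglongrightarrow> 0"
proof -
  obtain M where M: "\<And>k m n. M k \<le> m \<Longrightarrow> M k \<le> n \<Longrightarrow> sqnorm \<mu> (\<lambda>z. f m z - f n z) < (1/4)^k"
    using cauchy[of "(1/4)^k" for k] by (metis zero_less_divide_1_iff zero_less_numeral zero_less_power)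
  \<comment> \<open>a sum rather than \<open>M k\<close> itself, so that \<open>r\<close> dominates \<open>M k\<close> at both \<open>k\<close> and \<open>Suc k\<close>\<close>
  define r where "r k = (\<Sum>i\<le>k. M i)" for k
  have rM: "M k \<le> r k" "M k \<le> r (Suc k)" for k
    by (auto simp: r_def intro!: member_le_sum trans_le_add1)
  obtain g where g: "g \<in> L2 \<mu>" and lim: "(\<lambda>k. sqnorm \<mu> (\<lambda>z. f (r k) z - g z)) \<longlonglongrightarrow> 0"
    using rapid_cauchy_L2_limit[of "\<lambda>k. f (r k)" \<mu>] f less_imp_le[OF M[OF rM(2,1)]] by blast
  have "(\<lambda>k. sqnorm \<mu> (\<lambda>z. f k z - g z)) \<longlonglongrightarrow> 0"
  proof (rule LIMSEQ_I)
    fix \<epsilon> :: real assume \<epsilon>: "0 < \<epsilon>"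
    have "eventually (\<lambda>k. (1/4::real)^k < \<epsilon>/4) sequentially"
      using \<epsilon> by (intro order_tendstoD(2)[OF LIMSEQ_realpow_zero]) auto
    moreover have "eventually (\<lambda>k. sqnorm \<mu> (\<lambda>z. f (r k) z - g z) < \<epsilon>/4) sequentially"
      using \<epsilon> by (intro order_tendstoD(2)[OF lim]) auto
    ultimately obtain k where k: "(1/4::real)^k < \<epsilon>/4" "sqnorm \<mu> (\<lambda>z. f (r k) z - g z) < \<epsilon>/4"
      by (metis (mono_tags, lifting) eventually_conj eventually_sequentially order_refl)
    have "sqnorm \<mu> (\<lambda>z. f n z - g z) < \<epsilon>" if "M k \<le> n" for n
      using sqnorm_diff_le_via[OF f[of n] f[of "r k"] g] M[OF that rM(1)] k by linarith
    then show "\<exists>no. \<forall>n\<ge>no. norm (sqnorm \<mu> (\<lambda>z. f n z - g z) - 0) < \<epsilon>"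
      by auto
  qed
  with g show ?thesis by blast
qed

section \<open>Diagonal operators between orthogonal sequences\<close>

text \<open>
  The operator \<open>\<phi>\<^sub>k \<mapsto> s\<^sub>k\<close> between two orthogonal sequences, neither of which is normalised; its
  singular values are the square roots of the ratios that are assumed to tend to zero. In the application
  \<open>\<phi>\<close> enumerates the monomials and \<open>s\<close> enumerates their images under one of the operators \<open>S\<^sub>p\<close>.
\<close>

locale diagonal_operator =
  fixes \<mu> :: "(complex^'n) measure" and \<phi> s :: "nat \<Rightarrow> complex^'n \<Rightarrow> complex"
  assumes \<phi>: "\<And>k. \<phi> k \<in> L2 \<mu>" and s: "\<And>k. s k \<in> L2 \<mu>"
    and \<phi>_orth: "\<And>k l. k \<noteq> l \<Longrightarrow> L2_inner \<mu> (\<phi> k) (\<phi> l) = 0"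
    and s_orth: "\<And>k l. k \<noteq> l \<Longrightarrow> L2_inner \<mu> (s k) (s l) = 0"
    and pos: "\<And>k. 0 < sqnorm \<mu> (\<phi> k)"
    and ratio: "(\<lambda>k. sqnorm \<mu> (s k) / sqnorm \<mu> (\<phi> k)) \<longlonglongrightarrow> 0"
begin

definition coef :: "(complex^'n \<Rightarrow> complex) \<Rightarrow> nat \<Rightarrow> complex" where
  "coef f k = L2_inner \<mu> f (\<phi> k) / of_real (sqnorm \<mu> (\<phi> k))"

definition partial_sum :: "(complex^'n \<Rightarrow> complex) \<Rightarrow> nat \<Rightarrow> complex^'n \<Rightarrow> complex" where
  "partial_sum f m = (\<lambda>z. \<Sum>k<m. coef f k * s k z)"

text \<open>
  Defined on all of \<open>L\<^sup>2(d\<mu>)\<close>, where it vanishes on the orthogonal complement of the \<open>\<phi>\<^sub>k\<close>. The limit of the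
  partial sums is determined only up to almost everywhere equality. Since the choice depends
  on \<open>f\<close> through its Fourier coefficients alone, functions that agree almost everywhere have the same image.
\<close>

definition diag :: "(complex^'n \<Rightarrow> complex) \<Rightarrow> complex^'n \<Rightarrow> complex" where
  "diag f = (SOME g. g \<in> L2 \<mu> \<and> (\<lambda>m. sqnorm \<mu> (\<lambda>z. partial_sum f m z - g z)) \<longlonglongrightarrow> 0)"

lemma coef_bessel:
  assumes "f \<in> L2 \<mu>" "finite F"
  shows "(\<Sum>k\<in>F. (cmod (coef f k))\<^sup>2 * sqnorm \<mu> (\<phi> k)) \<le> sqnorm \<mu> f"
proof -
  have "(\<Sum>k\<in>F. (cmod (coef f k))\<^sup>2 * sqnorm \<mu> (\<phi> k))
      = (\<Sum>k\<in>F. (cmod (L2_inner \<mu> f (\<phi> k)))\<^sup>2 / sqnorm \<mu> (\<phi> k))"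
    using pos by (intro sum.cong refl)
      (auto simp: coef_def norm_divide power_divide power2_eq_square dest: less_imp_neq)
  also have "\<dots> \<le> sqnorm \<mu> f"
    using assms by (intro bessel \<phi> \<phi>_orth pos)
  finally show ?thesis .
qed

lemma coef_add: "f \<in> L2 \<mu> \<Longrightarrow> g \<in> L2 \<mu> \<Longrightarrow> coef (\<lambda>z. f z + g z) k = coef f k + coef g k"
  by (simp add: coef_def L2_inner_add_left \<phi> add_divide_distrib)

lemma coef_scale: "coef (\<lambda>z. b * f z) k = b * coef f k"
  by (simp add: coef_def L2_inner_scale_left)

lemma partial_sum_L2: "partial_sum f m \<in> L2 \<mu>"
  unfolding partial_sum_def by (intro L2_sum L2_scale s)

lemma sqnorm_series_le:
  assumes f: "f \<in> L2 \<mu>" and F: "finite F"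
    and \<delta>: "0 \<le> \<delta>" "\<And>k. k \<in> F \<Longrightarrow> sqnorm \<mu> (s k) / sqnorm \<mu> (\<phi> k) \<le> \<delta>"
  shows "sqnorm \<mu> (\<lambda>z. \<Sum>k\<in>F. coef f k * s k z)
    \<le> \<delta> * (\<Sum>k\<in>F. (cmod (coef f k))\<^sup>2 * sqnorm \<mu> (\<phi> k))"
proof -
  have "sqnorm \<mu> (\<lambda>z. \<Sum>k\<in>F. coef f k * s k z) = (\<Sum>k\<in>F. (cmod (coef f k))\<^sup>2 * sqnorm \<mu> (s k))"
    using F by (intro sqnorm_orthogonal_sum s s_orth)
  also have "\<dots> \<le> (\<Sum>k\<in>F. \<delta> * ((cmod (coef f k))\<^sup>2 * sqnorm \<mu> (\<phi> k)))"
  proof (rule sum_mono)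
    fix k assume "k \<in> F"
    then have "sqnorm \<mu> (s k) \<le> \<delta> * sqnorm \<mu> (\<phi> k)"
      using \<delta>(2)[of k] pos[of k] by (simp add: divide_le_eq)
    then show "(cmod (coef f k))\<^sup>2 * sqnorm \<mu> (s k) \<le> \<delta> * ((cmod (coef f k))\<^sup>2 * sqnorm \<mu> (\<phi> k))"
      using mult_left_mono[of "sqnorm \<mu> (s k)" "\<delta> * sqnorm \<mu> (\<phi> k)" "(cmod (coef f k))\<^sup>2"]
      by (simp add: mult.left_commute)
  qed
  finally show ?thesis by (simp add: sum_distrib_left)
qed

text \<open>
  By \<open>sqnorm_series_le\<close> and Bessel's inequality, blocks of the series far out are small because the
  ratios are.
\<close>

lemma diag_exists:
  assumes f: "f \<in> L2 \<mu>"
  shows "\<exists>g\<in>L2 \<mu>. (\<lambda>m. sqnorm \<mu> (\<lambda>z. partial_sum f m z - g z)) \<longlonglongrightarrow> 0"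
proof (rule L2_complete[OF partial_sum_L2])
  fix \<epsilon> :: real assume \<epsilon>: "0 < \<epsilon>"
  have B: "0 < sqnorm \<mu> f + 1"
    using sqnorm_nonneg[of \<mu> f] by linarith
  have "eventually (\<lambda>k. sqnorm \<mu> (s k) / sqnorm \<mu> (\<phi> k) < \<epsilon> / (sqnorm \<mu> f + 1)) sequentially"
    using \<epsilon> B by (intro order_tendstoD(2)[OF ratio]) auto
  then obtain M where M: "\<And>k. M \<le> k \<Longrightarrow> sqnorm \<mu> (s k) / sqnorm \<mu> (\<phi> k) < \<epsilon> / (sqnorm \<mu> f + 1)"
    by (auto simp: eventually_sequentially)
  have less: "sqnorm \<mu> (\<lambda>z. partial_sum f n z - partial_sum f m z) < \<epsilon>" if "M \<le> m" "m \<le> n" for m n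
  proof -
    have "partial_sum f n z - partial_sum f m z = (\<Sum>k\<in>{m..<n}. coef f k * s k z)" for z
      unfolding partial_sum_def using that(2)
      by (metis (no_types, lifting) atLeast0LessThan sum_diff_nat_ivl zero_le)
    then have "sqnorm \<mu> (\<lambda>z. partial_sum f n z - partial_sum f m z)
        = sqnorm \<mu> (\<lambda>z. \<Sum>k\<in>{m..<n}. coef f k * s k z)"
      by simp
    also have "\<dots> \<le> \<epsilon> / (sqnorm \<mu> f + 1) * (\<Sum>k\<in>{m..<n}. (cmod (coef f k))\<^sup>2 * sqnorm \<mu> (\<phi> k))"
      using that \<epsilon> B M by (intro sqnorm_series_le f) (auto intro!: less_imp_le)
    also have "\<dots> \<le> \<epsilon> / (sqnorm \<mu> f + 1) * sqnorm \<mu> f"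
      using \<epsilon> B by (intro mult_left_mono coef_bessel f) auto
    also have "\<dots> < \<epsilon>"
      using \<epsilon> B by (simp add: field_simps)
    finally show ?thesis .
  qed
  show "\<exists>M. \<forall>m\<ge>M. \<forall>n\<ge>M. sqnorm \<mu> (\<lambda>z. partial_sum f m z - partial_sum f n z) < \<epsilon>"
  proof (intro exI[of _ M] allI impI)
    fix m n assume "M \<le> m" "M \<le> n"
    then show "sqnorm \<mu> (\<lambda>z. partial_sum f m z - partial_sum f n z) < \<epsilon>"
      using less[of m n] less[of n m]
      by (cases "m \<le> n") (auto simp: sqnorm_minus_commute[of \<mu> "partial_sum f m" "partial_sum f n"])
  qed
qed

lemma
  assumes f: "f \<in> L2 \<mu>"
  shows diag_L2: "diag f \<in> L2 \<mu>"
    and partial_sum_tendsto: "(\<lambda>m. sqnorm \<mu> (\<lambda>z. partial_sum f m z - diag f z)) \<longlonglongrightarrow> 0"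
  using someI_ex[of "\<lambda>g. g \<in> L2 \<mu> \<and> (\<lambda>m. sqnorm \<mu> (\<lambda>z. partial_sum f m z - g z)) \<longlonglongrightarrow> 0"] diag_exists[OF f]
  unfolding diag_def by blast+

lemma diag_unique:
  assumes f: "f \<in> L2 \<mu>" and g: "g \<in> L2 \<mu>"
    and lim: "(\<lambda>m. sqnorm \<mu> (\<lambda>z. partial_sum f m z - g z)) \<longlonglongrightarrow> 0"
  shows "AE z in \<mu>. diag f z = g z"
proof -
  have "(\<lambda>m. 2 * sqnorm \<mu> (\<lambda>z. partial_sum f m z - diag f z) + 2 * sqnorm \<mu> (\<lambda>z. partial_sum f m z - g z))
      \<longlonglongrightarrow> 2 * 0 + 2 * 0"
    by (intro tendsto_intros partial_sum_tendsto f lim)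
  moreover have "sqnorm \<mu> (\<lambda>z. diag f z - g z)
      \<le> 2 * sqnorm \<mu> (\<lambda>z. partial_sum f m z - diag f z) + 2 * sqnorm \<mu> (\<lambda>z. partial_sum f m z - g z)" for m
    using sqnorm_diff_le_via[OF diag_L2[OF f] partial_sum_L2 g, of f m]
    by (simp add: sqnorm_minus_commute[of \<mu> "diag f"])
  ultimately have "sqnorm \<mu> (\<lambda>z. diag f z - g z) \<le> 0"
    by (intro LIMSEQ_le_const[of _ 0]) auto
  then have "sqnorm \<mu> (\<lambda>z. diag f z - g z) = 0"
    by (intro antisym) auto
  then have "AE z in \<mu>. diag f z - g z = 0"
    by (rule sqnorm_zero_AE[OF L2_diff[OF diag_L2[OF f] g]])
  then show ?thesis by simp
qed

lemma diag_cong_AE: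
  assumes "f \<in> L2 \<mu>" "g \<in> L2 \<mu>" "AE z in \<mu>. f z = g z"
  shows "diag f = diag g"
proof -
  have "coef f k = coef g k" for k
    unfolding coef_def using L2_inner_cong_AE[OF assms(1,2) \<phi> assms(3)] by simp
  then show ?thesis
    by (simp add: diag_def partial_sum_def)
qed

lemma diag_add:
  assumes f: "f \<in> L2 \<mu>" and g: "g \<in> L2 \<mu>"
  shows "AE z in \<mu>. diag (\<lambda>w. f w + g w) z = diag f z + diag g z"
proof (rule diag_unique[OF L2_add[OF f g] L2_add[OF diag_L2[OF f] diag_L2[OF g]]])
  have p: "partial_sum (\<lambda>w. f w + g w) m z = partial_sum f m z + partial_sum g m z" for m z
    by (simp add: partial_sum_def coef_add f g distrib_right sum.distrib)
  have "(\<lambda>m. 2 * sqnorm \<mu> (\<lambda>z. partial_sum f m z - diag f z) + 2 * sqnorm \<mu> (\<lambda>z. partial_sum g m z - diag g z))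
      \<longlonglongrightarrow> 2 * 0 + 2 * 0"
    by (intro tendsto_intros partial_sum_tendsto f g)
  then have lim: "(\<lambda>m. 2 * sqnorm \<mu> (\<lambda>z. partial_sum f m z - diag f z)
      + 2 * sqnorm \<mu> (\<lambda>z. partial_sum g m z - diag g z)) \<longlonglongrightarrow> 0"
    by simp
  have le: "sqnorm \<mu> (\<lambda>z. partial_sum (\<lambda>w. f w + g w) m z - (diag f z + diag g z))
      \<le> 2 * sqnorm \<mu> (\<lambda>z. partial_sum f m z - diag f z) + 2 * sqnorm \<mu> (\<lambda>z. partial_sum g m z - diag g z)" for m
    using sqnorm_add_le[OF L2_diff[OF partial_sum_L2 diag_L2[OF f]] L2_diff[OF partial_sum_L2 diag_L2[OF g]], of f m g m]
    by (simp add: p add_diff_add)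
  show "(\<lambda>m. sqnorm \<mu> (\<lambda>z. partial_sum (\<lambda>w. f w + g w) m z - (diag f z + diag g z))) \<longlonglongrightarrow> 0"
    by (rule tendsto_sandwich[OF _ _ tendsto_const lim]) (intro always_eventually allI sqnorm_nonneg le)+
qed

lemma diag_scale:
  assumes f: "f \<in> L2 \<mu>"
  shows "AE z in \<mu>. diag (\<lambda>w. b * f w) z = b * diag f z"
proof (rule diag_unique[OF L2_scale[OF f] L2_scale[OF diag_L2[OF f]]])
  have "partial_sum (\<lambda>w. b * f w) m z - b * diag f z = b * (partial_sum f m z - diag f z)" for m z
    by (simp add: partial_sum_def coef_scale sum_distrib_left right_diff_distrib mult.assoc)
  then have "sqnorm \<mu> (\<lambda>z. partial_sum (\<lambda>w. b * f w) m z - b * diag f z)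
      = (cmod b)\<^sup>2 * sqnorm \<mu> (\<lambda>z. partial_sum f m z - diag f z)" for m
    using sqnorm_scale[of \<mu> b "\<lambda>z. partial_sum f m z - diag f z"] by simp
  then show "(\<lambda>m. sqnorm \<mu> (\<lambda>z. partial_sum (\<lambda>w. b * f w) m z - b * diag f z)) \<longlonglongrightarrow> 0"
    using tendsto_mult_right_zero[OF partial_sum_tendsto[OF f], of "(cmod b)\<^sup>2"] by simp
qed

lemma diag_eq_finite_sum:
  assumes f: "f \<in> L2 \<mu>" and F: "finite F" "\<And>k. k \<notin> F \<Longrightarrow> coef f k = 0"
  shows "AE z in \<mu>. diag f z = (\<Sum>k\<in>F. coef f k * s k z)"
proof (rule diag_unique[OF f L2_sum[OF L2_scale[OF s]]])
  obtain N where N: "F \<subseteq> {..<N}"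
    using F(1) finite_nat_iff_bounded by blast
  have "partial_sum f m z = (\<Sum>k\<in>F. coef f k * s k z)" if "N \<le> m" for m z
    unfolding partial_sum_def using N that F by (intro sum.mono_neutral_right) auto
  then have "\<forall>\<^sub>F m in sequentially. sqnorm \<mu> (\<lambda>z. partial_sum f m z - (\<Sum>k\<in>F. coef f k * s k z)) = 0"
    by (intro eventually_sequentiallyI[of N]) (simp add: sqnorm_def)
  then show "(\<lambda>m. sqnorm \<mu> (\<lambda>z. partial_sum f m z - (\<Sum>k\<in>F. coef f k * s k z))) \<longlonglongrightarrow> 0"
    by (rule tendsto_eventually)
qed

text \<open>
  Splitting the series at \<open>K\<close> separates finitely many coefficients from a remainder that is small uniformly
  in \<open>f\<close>. The factor \<open>2\<close> comes from the quasi-triangle inequality in passing from partial sums to the limit.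
\<close>

lemma sqnorm_diag_le:
  assumes f: "f \<in> L2 \<mu>"
    and \<delta>: "0 \<le> \<delta>" "\<And>k. K \<le> k \<Longrightarrow> sqnorm \<mu> (s k) / sqnorm \<mu> (\<phi> k) \<le> \<delta>"
  shows "sqnorm \<mu> (diag f) \<le> 2 * ((\<Sum>k<K. (cmod (coef f k))\<^sup>2 * sqnorm \<mu> (s k)) + \<delta> * sqnorm \<mu> f)"
    (is "_ \<le> 2 * ?M")
proof -
  have part: "sqnorm \<mu> (partial_sum f m) \<le> ?M" if "K \<le> m" for m
  proof -
    have sq: "sqnorm \<mu> (\<lambda>z. \<Sum>k\<in>F. coef f k * s k z) = (\<Sum>k\<in>F. (cmod (coef f k))\<^sup>2 * sqnorm \<mu> (s k))"
      if "finite F" for F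
      using that by (intro sqnorm_orthogonal_sum s s_orth)
    have "sqnorm \<mu> (partial_sum f m) = (\<Sum>k<m. (cmod (coef f k))\<^sup>2 * sqnorm \<mu> (s k))"
      unfolding partial_sum_def by (rule sq) simp
    also have "\<dots> = (\<Sum>k<K. (cmod (coef f k))\<^sup>2 * sqnorm \<mu> (s k))
        + (\<Sum>k\<in>{K..<m}. (cmod (coef f k))\<^sup>2 * sqnorm \<mu> (s k))"
      using that by (metis (no_types, lifting) atLeast0LessThan sum.atLeastLessThan_concat zero_le)
    also have "(\<Sum>k\<in>{K..<m}. (cmod (coef f k))\<^sup>2 * sqnorm \<mu> (s k))
        \<le> \<delta> * (\<Sum>k\<in>{K..<m}. (cmod (coef f k))\<^sup>2 * sqnorm \<mu> (\<phi> k))"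
      using sqnorm_series_le[OF f _ \<delta>(1), of "{K..<m}"] \<delta>(2) by (simp add: sq)
    also have "\<dots> \<le> \<delta> * sqnorm \<mu> f"
      by (intro mult_left_mono coef_bessel f \<delta>) auto
    finally show ?thesis by simp
  qed
  have "(\<lambda>m. 2 * sqnorm \<mu> (\<lambda>z. partial_sum f m z - diag f z) + 2 * ?M) \<longlonglongrightarrow> 2 * 0 + 2 * ?M"
    by (intro tendsto_intros partial_sum_tendsto f)
  moreover have "sqnorm \<mu> (diag f) \<le> 2 * sqnorm \<mu> (\<lambda>z. partial_sum f m z - diag f z) + 2 * ?M"
    if "K \<le> m" for m
    using sqnorm_add_le[OF L2_diff[OF diag_L2[OF f] partial_sum_L2] partial_sum_L2, of f m f m] part[OF that]
    by (simp add: sqnorm_minus_commute[of \<mu> "diag f"])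
  ultimately show ?thesis
    by (intro LIMSEQ_le_const[of _ "2 * ?M"]) auto
qed

text \<open>
  This is the compactness of the operator: beyond a suitable \<open>K\<close> the tails contribute at most \<open>\<delta>\<close> times the
  bound on the sequence, and the first \<open>K\<close> coefficients converge.
\<close>

lemma diag_images_Cauchy:
  assumes f: "\<And>n. f n \<in> L2 \<mu>" and B: "\<And>n. sqnorm \<mu> (f n) \<le> B"
    and conv: "\<And>k. convergent (\<lambda>n. coef (f n) k)" and \<epsilon>: "0 < \<epsilon>"
  shows "\<exists>M. \<forall>m\<ge>M. \<forall>n\<ge>M. sqnorm \<mu> (\<lambda>z. diag (f m) z - diag (f n) z) < \<epsilon>"
proof -
  have B0: "0 \<le> B"
    using B[of 0] sqnorm_nonneg[of \<mu> "f 0"] by linarith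
  \<comment> \<open>differences of members of the sequence have squared norm at most \<open>4 * B\<close>; the summand \<open>1\<close> keeps the denominator positive\<close>
  define \<delta> where "\<delta> = \<epsilon> / (16 * (B + 1))"
  have \<delta>: "0 < \<delta>" and \<delta>B: "\<delta> * (4 * B) \<le> \<epsilon> / 4"
    using \<epsilon> B0 by (auto simp: \<delta>_def field_simps)
  have "eventually (\<lambda>k. sqnorm \<mu> (s k) / sqnorm \<mu> (\<phi> k) < \<delta>) sequentially"
    using \<delta> by (intro order_tendstoD(2)[OF ratio])
  then obtain K where K: "\<And>k. K \<le> k \<Longrightarrow> sqnorm \<mu> (s k) / sqnorm \<mu> (\<phi> k) \<le> \<delta>"
    by (auto simp: eventually_sequentially intro: less_imp_le)
  obtain L where L: "\<And>k. (\<lambda>n. coef (f n) k) \<longlonglongrightarrow> L k"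
    using conv unfolding convergent_def by metis
  have "(\<lambda>n. \<Sum>k<K. (cmod (coef (f n) k - L k))\<^sup>2 * sqnorm \<mu> (s k))
      \<longlonglongrightarrow> (\<Sum>k<K. (cmod (L k - L k))\<^sup>2 * sqnorm \<mu> (s k))"
    by (intro tendsto_intros L)
  then have "eventually (\<lambda>n. (\<Sum>k<K. (cmod (coef (f n) k - L k))\<^sup>2 * sqnorm \<mu> (s k)) < \<epsilon>/16) sequentially"
    using \<epsilon> by (intro order_tendstoD(2)) auto
  then obtain M where M: "\<And>n. M \<le> n \<Longrightarrow> (\<Sum>k<K. (cmod (coef (f n) k - L k))\<^sup>2 * sqnorm \<mu> (s k)) < \<epsilon>/16"
    by (auto simp: eventually_sequentially)
  have "sqnorm \<mu> (\<lambda>z. diag (f m) z - diag (f n) z) < \<epsilon>" if mn: "M \<le> m" "M \<le> n" for m n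
  proof -
    define h where "h = (\<lambda>z. f m z + (-1) * f n z)"
    have h: "h \<in> L2 \<mu>"
      unfolding h_def by (intro L2_add L2_scale f)
    have "AE z in \<mu>. diag h z = diag (f m) z + diag (\<lambda>w. (-1) * f n w) z"
      unfolding h_def by (intro diag_add L2_scale f)
    with diag_scale[OF f, of "-1" n] have "AE z in \<mu>. diag (f m) z - diag (f n) z = diag h z"
      by eventually_elim simp
    then have "sqnorm \<mu> (\<lambda>z. diag (f m) z - diag (f n) z) = sqnorm \<mu> (diag h)"
      by (intro sqnorm_cong_AE L2_diff diag_L2 f h)
    also have "\<dots> \<le> 2 * ((\<Sum>k<K. (cmod (coef h k))\<^sup>2 * sqnorm \<mu> (s k)) + \<delta> * sqnorm \<mu> h)"
      using K \<delta> by (intro sqnorm_diag_le h) auto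
    also have "\<dots> < 2 * (\<epsilon>/4 + \<epsilon>/4)"
    proof -
      have ch: "coef h k = coef (f m) k - coef (f n) k" for k
        unfolding h_def using coef_scale[of "-1" "f n" k] coef_add[OF f L2_scale[OF f], of m "-1" n k]
        by simp
      have "(\<Sum>k<K. (cmod (coef h k))\<^sup>2 * sqnorm \<mu> (s k))
        \<le> (\<Sum>k<K. (2 * (cmod (coef (f m) k - L k))\<^sup>2 + 2 * (cmod (coef (f n) k - L k))\<^sup>2) * sqnorm \<mu> (s k))"
      proof (intro sum_mono mult_right_mono)
        fix k
        show "(cmod (coef h k))\<^sup>2 \<le> 2 * (cmod (coef (f m) k - L k))\<^sup>2 + 2 * (cmod (coef (f n) k - L k))\<^sup>2"
          using cmod_add_sq_le[of "coef (f m) k - L k" "L k - coef (f n) k"]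
          by (simp add: ch norm_minus_commute)
      qed auto
      also have "\<dots> = 2 * (\<Sum>k<K. (cmod (coef (f m) k - L k))\<^sup>2 * sqnorm \<mu> (s k))
          + 2 * (\<Sum>k<K. (cmod (coef (f n) k - L k))\<^sup>2 * sqnorm \<mu> (s k))"
        by (simp add: distrib_right sum.distrib sum_distrib_left mult.assoc)
      also have "\<dots> < \<epsilon>/4"
        using M[OF mn(1)] M[OF mn(2)] by linarith
      finally have 1: "(\<Sum>k<K. (cmod (coef h k))\<^sup>2 * sqnorm \<mu> (s k)) < \<epsilon>/4" .
      have "sqnorm \<mu> h \<le> 2 * sqnorm \<mu> (f m) + 2 * sqnorm \<mu> (f n)"
        using sqnorm_add_le[OF f[of m] L2_scale[OF f[of n], of "-1"]] sqnorm_scale[of \<mu> "-1" "f n"]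
        by (simp add: h_def)
      then have "sqnorm \<mu> h \<le> 4 * B"
        using B[of m] B[of n] by linarith
      then have "\<delta> * sqnorm \<mu> h \<le> \<epsilon>/4"
        using \<delta> \<delta>B by (meson less_imp_le mult_left_mono order_trans)
      with 1 show ?thesis
        by (intro mult_strict_left_mono add_less_le_mono) auto
    qed
    finally show ?thesis by simp
  qed
  then show ?thesis by blast
qed

end

section \<open>Orthogonal monomials\<close>

locale orthogonal_monomials =
  fixes \<mu> :: "(complex^'n) measure"
  assumes borel: "sets \<mu> = sets borel"
    and orthogonal: "\<And>\<alpha> \<beta>. \<alpha> \<noteq> \<beta> \<Longrightarrow> L2_inner \<mu> (monomial \<alpha>) (monomial \<beta>) = 0"
    and finite_norm: "\<And>\<alpha>. integrable \<mu> (\<lambda>z. (cmod (monomial \<alpha> z))\<^sup>2)"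
    and pos_norm: "\<And>\<alpha>. 0 < (LINT z|\<mu>. (cmod (monomial \<alpha> z))\<^sup>2)"

text \<open>
  Moves the limit over the multiindices \<open>\<gamma>\<close> to one over all \<open>\<alpha> = \<gamma> + e\<^sub>p\<close> in \<open>\<nat>\<^sup>n\<close>.
\<close>

lemma tendsto_cofinite_range_iff:
  fixes f :: "'b \<Rightarrow> real" and h :: "'a \<Rightarrow> 'b"
  assumes "inj h" and f: "\<And>a. f (h a) = r a" and r: "\<And>a. 0 \<le> r a"
  shows "(f \<longlongrightarrow> 0) (inf cofinite (principal (range h))) \<longleftrightarrow> (\<forall>\<epsilon>>0. finite {a. \<epsilon> \<le> r a})"
proof -
  have "{b. \<not> (b \<in> range h \<longrightarrow> dist (f b) 0 < \<epsilon>)} = h ` {a. \<epsilon> \<le> r a}" for \<epsilon>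
    by (auto simp: f r not_less)
  then have "finite {b. \<not> (b \<in> range h \<longrightarrow> dist (f b) 0 < \<epsilon>)} \<longleftrightarrow> finite {a. \<epsilon> \<le> r a}" for \<epsilon>
    using finite_image_iff[OF inj_on_subset[OF \<open>inj h\<close> subset_UNIV], of "{a. \<epsilon> \<le> r a}"]
    by (simp only:)
  then show ?thesis
    unfolding tendsto_iff eventually_inf_principal eventually_cofinite by (simp only:)
qed

lemma monomial_add_axis: "monomial (\<alpha> + axis p 1) z = z $ p * monomial \<alpha> z"
proof -
  have "(\<Prod>i\<in>UNIV. (z $ i) ^ (axis p 1 $ i)) = (\<Prod>i\<in>UNIV. if i = p then z $ i else 1)"
    by (intro prod.cong) (auto simp: axis_def)
  then show ?thesis
    by (simp add: monomial_def power_add prod.distrib)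
qed

lemma minus_axis_add_axis: "(\<alpha> :: nat^'n) $ p \<noteq> 0 \<Longrightarrow> \<alpha> - axis p 1 + axis p 1 = \<alpha>"
  by (auto simp: vec_eq_iff axis_def)

lemma L2_inner_cnj_coordinate:
  "L2_inner \<mu> (\<lambda>z. cnj (z $ p) * f z) g = L2_inner \<mu> f (\<lambda>z. z $ p * g z)"
  by (simp add: L2_inner_def mult_ac)

lemma sqnorm_orthogonal_diff:
  assumes "f \<in> L2 \<mu>" "g \<in> L2 \<mu>" "L2_inner \<mu> f g = 0"
  shows "sqnorm \<mu> (\<lambda>z. f z - g z) = sqnorm \<mu> f + sqnorm \<mu> g"
proof -
  have "L2_inner \<mu> g f = 0"
    using L2_inner_cnj[of \<mu> g f] assms(3) by simp
  then have "complex_of_real (sqnorm \<mu> (\<lambda>z. f z - g z)) = of_real (sqnorm \<mu> f + sqnorm \<mu> g)"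
    using L2_inner_diff_left[OF assms(1,2) L2_diff[OF assms(1,2)]]
      L2_inner_diff_right[OF assms(1,2,1)] L2_inner_diff_right[OF assms(1,2,2)] assms(3)
    by (simp add: L2_inner_self[symmetric])
  then show ?thesis
    using of_real_eq_iff by blast
qed

lemma monomial_in_polynomials: "(\<lambda>z. c * monomial \<alpha> z) \<in> polynomials"
proof -
  have "(\<lambda>z. c * monomial \<alpha> z) = (\<lambda>z. \<Sum>\<beta>\<in>{\<alpha>}. (\<lambda>_. c) \<beta> * monomial \<beta> z)"
    by simp
  then show ?thesis
    unfolding polynomials_def by (intro CollectI exI[of _ "{\<alpha>}"] exI[of _ "\<lambda>_. c"]) simp
qed

context orthogonal_monomials
begin

lemma sqnorm_monomial_pos: "0 < sqnorm \<mu> (monomial \<alpha>)"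
  using pos_norm by (simp add: sqnorm_def)

lemma borel_measurable_borelI: "f \<in> borel_measurable borel \<Longrightarrow> f \<in> borel_measurable \<mu>"
  using measurable_cong_sets[OF borel refl] by blast

lemma monomial_L2: "monomial \<alpha> \<in> L2 \<mu>"
proof (rule L2_I)
  show "monomial \<alpha> \<in> borel_measurable \<mu>"
    unfolding monomial_def[abs_def]
    by (intro borel_measurable_borelI borel_measurable_continuous_onI continuous_intros)
qed (rule finite_norm)

lemma cnj_monomial_L2: "(\<lambda>z. cnj (z $ p) * monomial \<alpha> z) \<in> L2 \<mu>"
proof (rule L2_I)
  show "(\<lambda>z. cnj (z $ p) * monomial \<alpha> z) \<in> borel_measurable \<mu>"
    unfolding monomial_def[abs_def]
    by (intro borel_measurable_borelI borel_measurable_continuous_onI continuous_intros)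
  show "integrable \<mu> (\<lambda>z. (cmod (cnj (z $ p) * monomial \<alpha> z))\<^sup>2)"
    using finite_norm[of "\<alpha> + axis p 1"] by (simp add: monomial_add_axis norm_mult del: One_nat_def)
qed

lemma sqnorm_cnj_monomial:
  "sqnorm \<mu> (\<lambda>z. cnj (z $ p) * monomial \<alpha> z) = sqnorm \<mu> (monomial (\<alpha> + axis p 1))"
  by (simp add: sqnorm_def monomial_add_axis norm_mult del: One_nat_def)

lemma inner_monomials:
  "L2_inner \<mu> (monomial \<alpha>) (monomial \<beta>) = (if \<alpha> = \<beta> then of_real (sqnorm \<mu> (monomial \<alpha>)) else 0)"
  using orthogonal by (simp add: L2_inner_self)

lemma polynomials_L2: "p \<in> polynomials \<Longrightarrow> p \<in> L2 \<mu>"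
  unfolding polynomials_def by (auto intro!: L2_sum L2_scale monomial_L2)

lemma polynomials_A2: "p \<in> polynomials \<Longrightarrow> p \<in> A2 \<mu>"
  unfolding A2_def using polynomials_L2 by (auto simp: L2_norm_def intro!: bexI[of _ p])

text \<open>
  Orthogonality to polynomials passes to their closure because the inner product with \<open>f\<close> is continuous, by
  Cauchy--Schwarz.
\<close>

lemma orthogonal_A2:
  assumes f: "f \<in> L2 \<mu>" and orth: "\<And>\<beta>. L2_inner \<mu> f (monomial \<beta>) = 0" and g: "g \<in> A2 \<mu>"
  shows "L2_inner \<mu> f g = 0"
proof (rule ccontr)
  assume nz: "L2_inner \<mu> f g \<noteq> 0"
  have gL: "g \<in> L2 \<mu>"
    using g by (simp add: A2_def)
  define \<epsilon> where "\<epsilon> = cmod (L2_inner \<mu> f g) / (L2_norm \<mu> f + 1)"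
  have nf: "0 \<le> L2_norm \<mu> f"
    by (simp add: L2_norm_eq_sqrt)
  have "0 < \<epsilon>"
    using nz nf by (simp add: \<epsilon>_def add_nonneg_pos)
  then obtain p where p: "p \<in> polynomials" and close: "L2_norm \<mu> (\<lambda>z. g z - p z) < \<epsilon>"
    using g by (auto simp: A2_def)
  obtain F a where "p = (\<lambda>z. \<Sum>\<alpha>\<in>F. a \<alpha> * monomial \<alpha> z)"
    using p by (auto simp: polynomials_def)
  then have "L2_inner \<mu> f p = 0"
    using orth f by (simp add: L2_inner_sum_right L2_scale monomial_L2 L2_inner_scale_right)
  then have eq: "L2_inner \<mu> f (\<lambda>z. g z - p z) = L2_inner \<mu> f g"
    using f gL polynomials_L2[OF p] by (simp add: L2_inner_diff_right)
  have "(cmod (L2_inner \<mu> f g))\<^sup>2 \<le> (L2_norm \<mu> f * L2_norm \<mu> (\<lambda>z. g z - p z))\<^sup>2"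
    using cauchy_schwarz[OF f L2_diff[OF gL polynomials_L2[OF p]]] eq
    by (simp add: L2_norm_eq_sqrt power_mult_distrib)
  then have "cmod (L2_inner \<mu> f g) \<le> L2_norm \<mu> f * L2_norm \<mu> (\<lambda>z. g z - p z)"
    by (rule power2_le_imp_le) (simp add: L2_norm_eq_sqrt)
  also have "\<dots> \<le> L2_norm \<mu> f * \<epsilon>"
    using close nf by (intro mult_left_mono) auto
  also have "\<dots> < (L2_norm \<mu> f + 1) * \<epsilon>"
    using \<open>0 < \<epsilon>\<close> by simp
  also have "\<dots> = cmod (L2_inner \<mu> f g)"
    using nf by (simp add: \<epsilon>_def add_nonneg_eq_0_iff)
  finally show False by simp
qed

section \<open>The canonical solution on monomial forms\<close>

text \<open>
  The orthogonal projection of \<open>cnj z\<^sub>p z\<^sup>\<alpha>\<close> to \<open>A\<^sup>2(d\<mu>)\<close>; its coefficient is \<open>c\<^bsub>\<alpha> - e\<^sub>p\<^esub> / c\<^sub>\<alpha>\<close>. The case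
  distinction implements the convention \<open>c\<^sub>\<gamma> = 0\<close> for \<open>\<gamma>\<close> with a negative entry: for \<open>\<alpha>\<^sub>p = 0\<close> the truncated
  difference \<open>\<alpha> - e\<^sub>p\<close> is meaningless.
\<close>

definition projection_monomial :: "'n \<Rightarrow> nat^'n \<Rightarrow> complex^'n \<Rightarrow> complex" where
  "projection_monomial p \<alpha> = (\<lambda>z.
     (if \<alpha> $ p = 0 then 0 else of_real (sqnorm \<mu> (monomial \<alpha>) / sqnorm \<mu> (monomial (\<alpha> - axis p 1))))
       * monomial (\<alpha> - axis p 1) z)"

definition solution :: "'n \<Rightarrow> nat^'n \<Rightarrow> complex^'n \<Rightarrow> complex" where
  "solution p \<alpha> = (\<lambda>z. cnj (z $ p) * monomial \<alpha> z - projection_monomial p \<alpha> z)"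

lemma projection_monomial_polynomial: "projection_monomial p \<alpha> \<in> polynomials"
  unfolding projection_monomial_def by (rule monomial_in_polynomials)

lemma solution_L2: "solution p \<alpha> \<in> L2 \<mu>"
  unfolding solution_def
  by (intro L2_diff cnj_monomial_L2 polynomials_L2 projection_monomial_polynomial)

text \<open>
  Moving \<open>cnj z\<^sub>p\<close> to the other side as \<open>z\<^sub>p\<close>, the function \<open>cnj z\<^sub>p z\<^sup>\<alpha>\<close> meets only the monomial with
  \<open>\<beta> + e\<^sub>p = \<alpha>\<close>, and the coefficient of the projection is chosen to cancel that inner product.
\<close>

lemma solution_orthogonal_monomial: "L2_inner \<mu> (solution p \<alpha>) (monomial \<beta>) = 0"
proof -
  have "L2_inner \<mu> (\<lambda>z. cnj (z $ p) * monomial \<alpha> z) (monomial \<beta>)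
      = L2_inner \<mu> (monomial \<alpha>) (monomial (\<beta> + axis p 1))"
    unfolding L2_inner_cnj_coordinate monomial_add_axis[symmetric] ..
  also have "\<dots> = (if \<alpha> = \<beta> + axis p 1 then of_real (sqnorm \<mu> (monomial \<alpha>)) else 0)"
    by (rule inner_monomials)
  finally have 1: "L2_inner \<mu> (\<lambda>z. cnj (z $ p) * monomial \<alpha> z) (monomial \<beta>)
      = (if \<alpha> = \<beta> + axis p 1 then of_real (sqnorm \<mu> (monomial \<alpha>)) else 0)" .
  have shift: "\<alpha> = \<beta> + axis p 1 \<longleftrightarrow> \<alpha> $ p \<noteq> 0 \<and> \<alpha> - axis p 1 = \<beta>"
  proof
    assume "\<alpha> = \<beta> + axis p 1"
    then show "\<alpha> $ p \<noteq> 0 \<and> \<alpha> - axis p 1 = \<beta>" by simp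
  next
    assume "\<alpha> $ p \<noteq> 0 \<and> \<alpha> - axis p 1 = \<beta>"
    then show "\<alpha> = \<beta> + axis p 1" using minus_axis_add_axis[of \<alpha> p] by metis
  qed
  have 2: "L2_inner \<mu> (projection_monomial p \<alpha>) (monomial \<beta>)
      = (if \<alpha> = \<beta> + axis p 1 then of_real (sqnorm \<mu> (monomial \<alpha>)) else 0)"
    unfolding projection_monomial_def L2_inner_scale_left inner_monomials shift
    using sqnorm_monomial_pos[of \<beta>] by (simp add: less_imp_neq)
  have "L2_inner \<mu> (solution p \<alpha>) (monomial \<beta>)
      = L2_inner \<mu> (\<lambda>z. cnj (z $ p) * monomial \<alpha> z) (monomial \<beta>)
        - L2_inner \<mu> (projection_monomial p \<alpha>) (monomial \<beta>)"
    unfolding solution_def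
    by (rule L2_inner_diff_left[OF cnj_monomial_L2 polynomials_L2[OF projection_monomial_polynomial] monomial_L2])
  then show ?thesis
    by (simp only: 1 2 diff_self)
qed

lemma solution_orthogonal_A2: "g \<in> A2 \<mu> \<Longrightarrow> L2_inner \<mu> (solution p \<alpha>) g = 0"
  by (rule orthogonal_A2[OF solution_L2 solution_orthogonal_monomial])

lemma projection_orthogonal_cnj_monomial:
  assumes "\<alpha> \<noteq> \<beta>"
  shows "L2_inner \<mu> (projection_monomial p \<alpha>) (\<lambda>z. cnj (z $ p) * monomial \<beta> z) = 0"
proof (cases "\<alpha> $ p = 0")
  case False
  have "L2_inner \<mu> (\<lambda>z. cnj (z $ p) * monomial \<beta> z) (monomial (\<alpha> - axis p 1)) = 0"
    unfolding L2_inner_cnj_coordinate monomial_add_axis[symmetric] minus_axis_add_axis[OF False]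
    using assms orthogonal[of \<beta> \<alpha>] by simp
  then have "L2_inner \<mu> (monomial (\<alpha> - axis p 1)) (\<lambda>z. cnj (z $ p) * monomial \<beta> z) = 0"
    using L2_inner_cnj by (metis complex_cnj_zero)
  then show ?thesis
    by (simp add: projection_monomial_def L2_inner_scale_left)
qed (simp add: projection_monomial_def L2_inner_def)

text \<open>
  This makes \<open>S\<^sub>p\<close> diagonal. As \<open>solution p \<alpha>\<close> is orthogonal to \<open>A\<^sup>2(d\<mu>)\<close>, it suffices to pair it with
  \<open>cnj z\<^sub>p z\<^sup>\<beta>\<close>. There the factor \<open>\<bar>z\<^sub>p\<bar>\<^sup>2\<close> shifts both multiindices by \<open>e\<^sub>p\<close>, and the projection term
  reduces to the inner product of \<open>z\<^sup>\<alpha>\<close> and \<open>z\<^sup>\<beta>\<close>.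
\<close>

lemma solution_orthogonal:
  assumes "\<alpha> \<noteq> \<beta>"
  shows "L2_inner \<mu> (solution p \<alpha>) (solution p \<beta>) = 0"
proof -
  have "L2_inner \<mu> (\<lambda>z. cnj (z $ p) * monomial \<alpha> z) (\<lambda>z. cnj (z $ p) * monomial \<beta> z)
      = L2_inner \<mu> (monomial (\<alpha> + axis p 1)) (monomial (\<beta> + axis p 1))"
    by (simp add: L2_inner_def monomial_add_axis mult_ac del: One_nat_def)
  then have "L2_inner \<mu> (\<lambda>z. cnj (z $ p) * monomial \<alpha> z) (\<lambda>z. cnj (z $ p) * monomial \<beta> z) = 0"
    using assms by (simp add: inner_monomials)
  moreover have "L2_inner \<mu> (solution p \<alpha>) (\<lambda>z. cnj (z $ p) * monomial \<beta> z)
      = L2_inner \<mu> (\<lambda>z. cnj (z $ p) * monomial \<alpha> z) (\<lambda>z. cnj (z $ p) * monomial \<beta> z)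
        - L2_inner \<mu> (projection_monomial p \<alpha>) (\<lambda>z. cnj (z $ p) * monomial \<beta> z)"
    unfolding solution_def
    by (rule L2_inner_diff_left[OF cnj_monomial_L2 polynomials_L2[OF projection_monomial_polynomial] cnj_monomial_L2])
  moreover have "L2_inner \<mu> (solution p \<alpha>) (solution p \<beta>)
      = L2_inner \<mu> (solution p \<alpha>) (\<lambda>z. cnj (z $ p) * monomial \<beta> z)
        - L2_inner \<mu> (solution p \<alpha>) (projection_monomial p \<beta>)"
    unfolding solution_def[of p \<beta>]
    by (rule L2_inner_diff_right[OF cnj_monomial_L2 polynomials_L2[OF projection_monomial_polynomial] solution_L2])
  ultimately show ?thesis
    using projection_orthogonal_cnj_monomial[OF assms, of p]
      solution_orthogonal_A2[OF polynomials_A2[OF projection_monomial_polynomial], of p \<alpha> p \<beta>]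
    by (simp only: diff_self)
qed

text \<open>
  Pythagoras for \<open>cnj z\<^sub>p z\<^sup>\<alpha>\<close> split into its projection and the orthogonal remainder.
\<close>

lemma sqnorm_solution:
  "sqnorm \<mu> (solution p \<alpha>) = sqnorm \<mu> (monomial (\<alpha> + axis p 1)) -
     (if \<alpha> $ p = 0 then 0 else (sqnorm \<mu> (monomial \<alpha>))\<^sup>2 / sqnorm \<mu> (monomial (\<alpha> - axis p 1)))"
proof -
  have L: "projection_monomial p \<alpha> \<in> L2 \<mu>"
    by (intro polynomials_L2 projection_monomial_polynomial)
  have "L2_inner \<mu> (solution p \<alpha>) (projection_monomial p \<alpha>) = 0"
    by (intro solution_orthogonal_A2 polynomials_A2 projection_monomial_polynomial)
  then have "L2_inner \<mu> (solution p \<alpha>) (\<lambda>z. - 1 * projection_monomial p \<alpha> z) = 0"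
    by (simp only: L2_inner_scale_right mult_zero_right)
  from sqnorm_orthogonal_diff[OF solution_L2 L2_scale[OF L] this]
  have "sqnorm \<mu> (\<lambda>z. cnj (z $ p) * monomial \<alpha> z)
      = sqnorm \<mu> (solution p \<alpha>) + sqnorm \<mu> (projection_monomial p \<alpha>)"
    using sqnorm_scale[of \<mu> "-1" "projection_monomial p \<alpha>"] by (simp add: solution_def)
  moreover have "sqnorm \<mu> (projection_monomial p \<alpha>)
      = (if \<alpha> $ p = 0 then 0 else (sqnorm \<mu> (monomial \<alpha>))\<^sup>2 / sqnorm \<mu> (monomial (\<alpha> - axis p 1)))"
    unfolding projection_monomial_def sqnorm_scale
    using sqnorm_monomial_pos[of "\<alpha> - axis p 1"]
    by (simp add: norm_divide power_divide power2_eq_square less_imp_neq)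
  ultimately show ?thesis
    by (simp add: sqnorm_cnj_monomial)
qed

text \<open>
  The explicit solution has the defining properties, so the chosen one does too. The difference
  \<open>d\<close> of the two lies in \<open>A\<^sup>2(d\<mu>) + A\<^sup>2(d\<mu>)\<close> and is orthogonal to \<open>A\<^sup>2(d\<mu>)\<close>, hence orthogonal to itself.
\<close>

lemma canonical_solution_monomial_AE:
  "canonical_solution_monomial \<mu> \<alpha> p \<in> L2 \<mu>"
  "AE z in \<mu>. canonical_solution_monomial \<mu> \<alpha> p z = solution p \<alpha> z"
proof -
  let ?P = "\<lambda>f. f \<in> L2 \<mu> \<and> (\<lambda>z. f z - cnj (z $ p) * monomial \<alpha> z) \<in> A2 \<mu> \<and>
    (\<forall>g\<in>A2 \<mu>. L2_inner \<mu> f g = 0)"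
  let ?f = "canonical_solution_monomial \<mu> \<alpha> p"
  let ?c = "(if \<alpha> $ p = 0 then 0 else sqnorm \<mu> (monomial \<alpha>) / sqnorm \<mu> (monomial (\<alpha> - axis p 1)))"
  have "(\<lambda>z. solution p \<alpha> z - cnj (z $ p) * monomial \<alpha> z) = (\<lambda>z. - of_real ?c * monomial (\<alpha> - axis p 1) z)"
    by (auto simp: solution_def projection_monomial_def)
  then have "(\<lambda>z. solution p \<alpha> z - cnj (z $ p) * monomial \<alpha> z) \<in> A2 \<mu>"
    by (simp only: polynomials_A2 monomial_in_polynomials)
  then have "?P (solution p \<alpha>)"
    by (simp add: solution_L2 solution_orthogonal_A2)
  then have P: "?P ?f"
    unfolding canonical_solution_monomial_def by (rule someI[where P = ?P])
  then show fL: "?f \<in> L2 \<mu>" by blast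
  let ?u = "\<lambda>z. ?f z - cnj (z $ p) * monomial \<alpha> z"
  let ?d = "\<lambda>z. ?f z - solution p \<alpha> z"
  have uA: "?u \<in> A2 \<mu>" and uL: "?u \<in> L2 \<mu>" using P by (auto simp: A2_def)
  have lA: "projection_monomial p \<alpha> \<in> A2 \<mu>" and lL: "projection_monomial p \<alpha> \<in> L2 \<mu>"
    using polynomials_A2 polynomials_L2 projection_monomial_polynomial by blast+
  have dL: "?d \<in> L2 \<mu>" by (intro L2_diff fL solution_L2)
  have orth: "L2_inner \<mu> ?d g = 0" if "g \<in> A2 \<mu>" for g
    using that P solution_orthogonal_A2[OF that] by (subst L2_inner_diff_left[OF fL solution_L2]) (auto simp: A2_def)
  have "?d = (\<lambda>z. ?u z + projection_monomial p \<alpha> z)"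
    by (simp add: solution_def algebra_simps)
  then have "L2_inner \<mu> ?d ?d = L2_inner \<mu> (\<lambda>z. ?u z + projection_monomial p \<alpha> z) ?d"
    by (rule arg_cong)
  also have "\<dots> = L2_inner \<mu> ?u ?d + L2_inner \<mu> (projection_monomial p \<alpha>) ?d"
    by (rule L2_inner_add_left[OF uL lL dL])
  also have "\<dots> = 0"
    using orth[OF uA] orth[OF lA] L2_inner_cnj[of \<mu> ?u ?d] L2_inner_cnj[of \<mu> "projection_monomial p \<alpha>" ?d]
    by simp
  finally have "sqnorm \<mu> ?d = 0"
    by (simp add: L2_inner_self)
  then have "AE z in \<mu>. ?d z = 0"
    by (rule sqnorm_zero_AE[OF dL])
  then show "AE z in \<mu>. ?f z = solution p \<alpha> z" by simp
qed

lemma ratio_eq_c_coeff: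
  fixes \<alpha> :: "nat^'n" and p :: 'n
  defines "\<gamma> \<equiv> (\<chi> i. int (\<alpha> $ i)) - axis p 1"
  shows "c_coeff \<mu> (\<gamma> + axis p 1) / c_coeff \<mu> (\<gamma> + axis p 2) - c_coeff \<mu> \<gamma> / c_coeff \<mu> (\<gamma> + axis p 1)
    = sqnorm \<mu> (solution p \<alpha>) / sqnorm \<mu> (monomial \<alpha>)"
proof -
  have c: "c_coeff \<mu> (\<chi> i. int (\<beta> $ i)) = inverse (sqnorm \<mu> (monomial \<beta>))" for \<beta> :: "nat^'n"
    by (simp add: c_coeff_def sqnorm_def)
  have g1: "\<gamma> + axis p 1 = (\<chi> i. int (\<alpha> $ i))"
    by (simp add: \<gamma>_def)
  have g2: "\<gamma> + axis p 2 = (\<chi> i. int ((\<alpha> + axis p 1) $ i))"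
    by (auto simp: \<gamma>_def vec_eq_iff axis_def)
  have g0: "c_coeff \<mu> \<gamma> = (if \<alpha> $ p = 0 then 0 else inverse (sqnorm \<mu> (monomial (\<alpha> - axis p 1))))"
  proof (cases "\<alpha> $ p = 0")
    case True
    then have "\<gamma> $ p < 0" by (simp add: \<gamma>_def)
    then show ?thesis using True by (auto simp: c_coeff_def)
  next
    case False
    then have g: "\<gamma> = (\<chi> i. int ((\<alpha> - axis p 1) $ i))"
      by (auto simp: \<gamma>_def vec_eq_iff axis_def)
    have "c_coeff \<mu> \<gamma> = inverse (sqnorm \<mu> (monomial (\<alpha> - axis p 1)))"
      unfolding g by (rule c)
    with False show ?thesis by (simp only: if_False)
  qed
  have nz: "sqnorm \<mu> (monomial \<beta>) \<noteq> 0" for \<beta>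
    using sqnorm_monomial_pos[of \<beta>] by simp
  have field: "inverse a / inverse b - (if Q then 0 else inverse d) / inverse a
      = (b - (if Q then 0 else a\<^sup>2 / d)) / a" if "a \<noteq> 0" "b \<noteq> 0" "d \<noteq> 0" for a b d :: real and Q
    using that by (cases Q) (simp_all add: field_simps power2_eq_square)
  show ?thesis
    unfolding g1 g2 g0 c sqnorm_solution by (rule field[OF nz nz nz])
qed

text \<open>
  The limit of the theorem runs over exactly the \<open>\<gamma> = \<alpha> - e\<^sub>p\<close> with \<open>\<alpha> \<in> \<nat>\<^sup>n\<close>: only the entry at \<open>p\<close> can
  become \<open>-1\<close>.
\<close>

lemma range_shifted_index:
  "range (\<lambda>\<alpha> :: nat^'n. (\<chi> i. int (\<alpha> $ i)) - axis p 1)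
    = {\<gamma> \<in> multiindices. \<forall>i. (\<gamma> + axis p 1) $ i \<ge> 0}" (is "range ?idx = ?X")
proof (intro equalityI subsetI)
  fix \<gamma> :: "int^'n" assume "\<gamma> \<in> range ?idx"
  then obtain \<alpha> where \<gamma>: "\<gamma> = ?idx \<alpha>" by blast
  have "{i. \<gamma> $ i = -1} \<subseteq> {p}"
    unfolding \<gamma> by (auto simp: axis_def split: if_splits)
  then have "card {i. \<gamma> $ i = -1} \<le> card {p}"
    by (intro card_mono) auto
  moreover have "-1 \<le> \<gamma> $ i" "0 \<le> (\<gamma> + axis p 1) $ i" for i
    unfolding \<gamma> by (simp_all add: axis_def)
  ultimately show "\<gamma> \<in> ?X"
    by (simp add: multiindices_def)
next
  fix \<gamma> :: "int^'n" assume "\<gamma> \<in> ?X"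
  then have "0 \<le> (\<gamma> + axis p 1) $ i" for i
    by blast
  then have "\<gamma> = ?idx (\<chi> i. nat ((\<gamma> + axis p 1) $ i))"
    by (simp add: vec_eq_iff)
  then show "\<gamma> \<in> range ?idx" by (rule range_eqI)
qed

lemma tendsto_c_coeff_iff:
  "((\<lambda>\<gamma>. c_coeff \<mu> (\<gamma> + axis p 1) / c_coeff \<mu> (\<gamma> + axis p 2) - c_coeff \<mu> \<gamma> / c_coeff \<mu> (\<gamma> + axis p 1))
      \<longlongrightarrow> 0) (inf cofinite (principal {\<gamma> \<in> multiindices. \<forall>i. (\<gamma> + axis p 1) $ i \<ge> 0}))
    \<longleftrightarrow> (\<forall>\<epsilon>>0. finite {\<alpha>. \<epsilon> \<le> sqnorm \<mu> (solution p \<alpha>) / sqnorm \<mu> (monomial \<alpha>)})"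
  (is "(?f \<longlongrightarrow> 0) (inf cofinite (principal ?X)) \<longleftrightarrow> _")
proof -
  let ?idx = "\<lambda>\<alpha> :: nat^'n. (\<chi> i. int (\<alpha> $ i)) - axis p 1"
  have inj: "inj ?idx"
    by (rule injI) (simp add: vec_eq_iff)
  have "(?f \<longlongrightarrow> 0) (inf cofinite (principal (range ?idx)))
      \<longleftrightarrow> (\<forall>\<epsilon>>0. finite {\<alpha>. \<epsilon> \<le> sqnorm \<mu> (solution p \<alpha>) / sqnorm \<mu> (monomial \<alpha>)})"
    by (rule tendsto_cofinite_range_iff[OF inj]) (rule ratio_eq_c_coeff, simp)
  then show ?thesis
    by (simp only: range_shifted_index)
qed

end

section \<open>Forms with polynomial coefficients\<close>

lemma coordinate_L2_norm_le_form_norm: "L2_norm \<mu> (\<lambda>z. \<omega> z $ j) \<le> form_norm \<mu> \<omega>"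
proof -
  have "(L2_norm \<mu> (\<lambda>z. \<omega> z $ j))\<^sup>2 \<le> (\<Sum>j\<in>UNIV. (L2_norm \<mu> (\<lambda>z. \<omega> z $ j))\<^sup>2)"
    by (rule member_le_sum) auto
  then show ?thesis
    unfolding form_norm_def by (rule real_le_rsqrt)
qed

context orthogonal_monomials
begin

lemma inner_poly_form_monomial:
  assumes "finite {\<alpha>. a \<alpha> \<noteq> 0}"
  shows "L2_inner \<mu> (\<lambda>z. poly_form a z $ j) (monomial \<beta>) = a \<beta> $ j * of_real (sqnorm \<mu> (monomial \<beta>))"
proof -
  have "L2_inner \<mu> (\<lambda>z. poly_form a z $ j) (monomial \<beta>)
      = (\<Sum>\<alpha> | a \<alpha> \<noteq> 0. a \<alpha> $ j * L2_inner \<mu> (monomial \<alpha>) (monomial \<beta>))"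
    by (simp add: poly_form_def L2_inner_sum_left L2_scale monomial_L2 L2_inner_scale_left)
  also have "\<dots> = (\<Sum>\<alpha> | a \<alpha> \<noteq> 0. if \<alpha> = \<beta> then a \<beta> $ j * of_real (sqnorm \<mu> (monomial \<beta>)) else 0)"
    by (intro sum.cong refl) (simp add: inner_monomials)
  also have "\<dots> = a \<beta> $ j * of_real (sqnorm \<mu> (monomial \<beta>))"
    using assms by simp
  finally show ?thesis .
qed

text \<open>
  The coefficients are recovered from the form by taking inner products with the monomials.
\<close>

lemma poly_form_inj:
  fixes a b :: "nat^'n \<Rightarrow> complex^'n"
  assumes "finite {\<alpha>. a \<alpha> \<noteq> 0}" "finite {\<alpha>. b \<alpha> \<noteq> 0}" "poly_form a = poly_form b"
  shows "a = b"
proof (rule ext)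
  fix \<beta>
  have "a \<beta> $ j = b \<beta> $ j" for j
    using inner_poly_form_monomial[OF assms(1), of j \<beta>] inner_poly_form_monomial[OF assms(2), of j \<beta>]
      sqnorm_monomial_pos[of \<beta>] assms(3) by simp
  then show "a \<beta> = b \<beta>" by (simp add: vec_eq_iff)
qed

lemma form_coeffs_poly_form:
  fixes a :: "nat^'n \<Rightarrow> complex^'n"
  assumes "finite {\<alpha>. a \<alpha> \<noteq> 0}"
  shows "form_coeffs (poly_form a) = a"
  unfolding form_coeffs_def using assms poly_form_inj by (intro the_equality) auto

lemma poly_form_component_polynomial:
  assumes "finite {\<alpha>. a \<alpha> \<noteq> 0}"
  shows "(\<lambda>z. poly_form a z $ j) \<in> polynomials"
  unfolding polynomials_def poly_form_def vec_lambda_beta using assms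
  by (intro CollectI exI[of _ "{\<alpha>. a \<alpha> \<noteq> 0}"] exI[of _ "\<lambda>\<alpha>. a \<alpha> $ j"]) simp

lemma poly_form_A2_01: "finite {\<alpha>. a \<alpha> \<noteq> 0} \<Longrightarrow> poly_form a \<in> A2_01 \<mu>"
  unfolding A2_01_def using polynomials_A2 poly_form_component_polynomial by blast

lemma A2_01_component_L2: "\<omega> \<in> A2_01 \<mu> \<Longrightarrow> (\<lambda>z. \<omega> z $ j) \<in> L2 \<mu>"
  by (auto simp: A2_01_def A2_def)

lemma canonical_solution_poly_form_AE:
  assumes "finite {\<alpha>. a \<alpha> \<noteq> 0}"
  shows "AE z in \<mu>. canonical_solution \<mu> (poly_form a) z
    = (\<Sum>\<alpha> | a \<alpha> \<noteq> 0. \<Sum>j\<in>UNIV. a \<alpha> $ j * solution j \<alpha> z)"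
proof -
  have "AE z in \<mu>. \<forall>\<alpha>\<in>{\<alpha>. a \<alpha> \<noteq> 0}. \<forall>j\<in>UNIV. canonical_solution_monomial \<mu> \<alpha> j z = solution j \<alpha> z"
    using assms canonical_solution_monomial_AE(2) by (intro AE_finite_allI) auto
  then show ?thesis
    by eventually_elim (simp add: canonical_solution_def form_coeffs_poly_form[OF assms])
qed

section \<open>The compactness criterion\<close>

text \<open>
  Suppose infinitely many ratios were at least \<open>\<epsilon>\<close>. The corresponding normalised monomials times \<open>d\<close>-bar
  \<open>z\<^sub>p\<close> have form norm \<open>1\<close>, and their images are pairwise orthogonal with squared norms at least \<open>\<epsilon>\<close>; a sequence
  that is separated in this way has no convergent subsequence.
\<close>

lemma canonical_solution_compact_imp_ratio:
  assumes "canonical_solution_operator_compact \<mu>" and \<epsilon>: "0 < \<epsilon>"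
  shows "finite {\<alpha>. \<epsilon> \<le> sqnorm \<mu> (solution p \<alpha>) / sqnorm \<mu> (monomial \<alpha>)}" (is "finite ?A")
proof (rule ccontr)
  assume "infinite ?A"
  then obtain h :: "nat \<Rightarrow> nat^'n" where h: "inj h" "range h \<subseteq> ?A"
    using infinite_countable_subset by blast
  obtain T where T: "compact_operator_A2_01_L2 \<mu> T"
    and TS: "\<And>\<omega>. \<omega> \<in> poly_forms \<Longrightarrow> AE z in \<mu>. T \<omega> z = canonical_solution \<mu> \<omega> z"
    using assms(1) unfolding canonical_solution_operator_compact_def by blast
  define c where "c k = complex_of_real (1 / sqrt (sqnorm \<mu> (monomial (h k))))" for k
  have c2: "(cmod (c k))\<^sup>2 = 1 / sqnorm \<mu> (monomial (h k))" for k
    by (simp add: c_def norm_divide power_divide)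
  have c0: "c k \<noteq> 0" for k
    using sqnorm_monomial_pos[of "h k"] by (simp add: c_def)
  define a where "a k = (\<lambda>\<alpha>. if \<alpha> = h k then axis p (c k) else 0)" for k
  have supp: "{\<alpha>. a k \<alpha> \<noteq> 0} = {h k}" for k
    using c0[of k] by (auto simp: a_def axis_eq_0_iff)
  then have fin: "finite {\<alpha>. a k \<alpha> \<noteq> 0}" for k by simp
  define \<Omega> where "\<Omega> k = poly_form (a k)" for k
  have \<Omega>_A: "\<Omega> k \<in> A2_01 \<mu>" for k
    unfolding \<Omega>_def by (rule poly_form_A2_01[OF fin])
  have \<Omega>_comp: "(\<lambda>z. \<Omega> k z $ j) = (\<lambda>z. axis p (c k) $ j * monomial (h k) z)" for k j
    unfolding \<Omega>_def poly_form_def supp by (simp add: a_def)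
  have "form_norm \<mu> (\<Omega> k) \<le> 1" for k
  proof -
    have "(L2_norm \<mu> (\<lambda>z. \<Omega> k z $ j))\<^sup>2 = (if j = p then 1 else 0)" for j
      unfolding \<Omega>_comp L2_norm_eq_sqrt sqnorm_scale
      using sqnorm_monomial_pos[of "h k"] by (simp add: axis_def c2)
    then show ?thesis
      by (simp add: form_norm_def)
  qed
  then obtain f r where f: "f \<in> L2 \<mu>" and r: "strict_mono r"
    and lim: "(\<lambda>k. L2_norm \<mu> (\<lambda>z. T (\<Omega> (r k)) z - f z)) \<longlonglongrightarrow> 0"
    using T \<Omega>_A unfolding compact_operator_A2_01_L2_def by blast
  have TL: "T (\<Omega> k) \<in> L2 \<mu>" for k
    using T \<Omega>_A unfolding compact_operator_A2_01_L2_def by blast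
  have TAE: "AE z in \<mu>. T (\<Omega> k) z = c k * solution p (h k) z" for k
  proof -
    have "\<Omega> k \<in> poly_forms"
      unfolding \<Omega>_def poly_forms_def using fin by blast
    from TS[OF this] canonical_solution_poly_form_AE[OF fin[of k]]
    show ?thesis
    proof eventually_elim
      case (elim z)
      have "T (\<Omega> k) z = (\<Sum>j\<in>UNIV. axis p (c k) $ j * solution j (h k) z)"
        using elim by (simp add: \<Omega>_def supp) (simp add: a_def)
      also have "\<dots> = (\<Sum>j\<in>UNIV. if j = p then c k * solution p (h k) z else 0)"
        by (intro sum.cong refl) (simp add: axis_def)
      finally show ?case by simp
    qed
  qed
  have sep: "2 * \<epsilon> \<le> sqnorm \<mu> (\<lambda>z. T (\<Omega> k) z - T (\<Omega> l) z)" if "k \<noteq> l" for k l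
  proof -
    have L: "(\<lambda>z. c k * solution p (h k) z) \<in> L2 \<mu>" for k
      by (intro L2_scale solution_L2)
    have hkl: "h k \<noteq> h l"
      using that h(1) by (simp add: inj_eq)
    have "AE z in \<mu>. T (\<Omega> k) z - T (\<Omega> l) z = c k * solution p (h k) z - c l * solution p (h l) z"
      using TAE[of k] TAE[of l] by eventually_elim simp
    then have "sqnorm \<mu> (\<lambda>z. T (\<Omega> k) z - T (\<Omega> l) z)
        = sqnorm \<mu> (\<lambda>z. c k * solution p (h k) z - c l * solution p (h l) z)"
      by (intro sqnorm_cong_AE L2_diff TL L)
    also have "\<dots> = sqnorm \<mu> (\<lambda>z. c k * solution p (h k) z) + sqnorm \<mu> (\<lambda>z. c l * solution p (h l) z)"
      by (rule sqnorm_orthogonal_diff[OF L L])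
        (simp add: L2_inner_scale_left L2_inner_scale_right solution_orthogonal[OF hkl])
    also have "\<dots> \<ge> 2 * \<epsilon>"
    proof -
      have "\<epsilon> \<le> sqnorm \<mu> (\<lambda>z. c k * solution p (h k) z)" for k
        using h(2) unfolding sqnorm_scale c2 by (auto simp: subset_iff)
      from this[of k] this[of l] show ?thesis by linarith
    qed
    finally show ?thesis .
  qed
  have "(\<lambda>k. sqnorm \<mu> (\<lambda>z. T (\<Omega> (r k)) z - f z)) \<longlonglongrightarrow> 0"
    using lim by (simp add: L2_norm_tendsto_0_iff)
  then have "\<forall>\<^sub>F k in sequentially. sqnorm \<mu> (\<lambda>z. T (\<Omega> (r k)) z - f z) < \<epsilon> / 4"
    using \<epsilon> by (intro order_tendstoD(2)) auto
  then obtain k where k: "\<And>l. k \<le> l \<Longrightarrow> sqnorm \<mu> (\<lambda>z. T (\<Omega> (r l)) z - f z) < \<epsilon> / 4"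
    by (auto simp: eventually_sequentially)
  have "r k \<noteq> r (Suc k)"
    using r by (simp add: strict_mono_eq)
  from sep[OF this] sqnorm_diff_le_via[OF TL f TL, of "r k" "r (Suc k)"] k[of k] k[of "Suc k"] \<epsilon>
  show False
    by (simp add: sqnorm_minus_commute[of \<mu> f])
qed

lemma infinite_UNIV_multiindex: "infinite (UNIV :: (nat^'n) set)"
proof -
  have "inj (\<lambda>k :: nat. (\<chi> i. k) :: nat^'n)"
    by (rule injI) (simp add: vec_eq_iff)
  then show ?thesis
    using finite_subset[OF subset_UNIV] finite_imageD infinite_UNIV_nat by metis
qed

text \<open>
  The extension of \<open>S\<close> is the sum over \<open>p\<close> of the diagonal operators \<open>z\<^sup>\<alpha> \<mapsto> S(z\<^sup>\<alpha> d\<close>-bar \<open>z\<^sub>p)\<close>, along a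
  fixed enumeration of the multiindices.
\<close>

lemma ratio_imp_canonical_solution_compact:
  assumes ratio: "\<And>p \<epsilon>. 0 < \<epsilon> \<Longrightarrow> finite {\<alpha>. \<epsilon> \<le> sqnorm \<mu> (solution p \<alpha>) / sqnorm \<mu> (monomial \<alpha>)}"
  shows "canonical_solution_operator_compact \<mu>"
proof -
  obtain e :: "nat \<Rightarrow> nat^'n" where e: "bij e"
    using bij_betw_from_nat_into[OF _ infinite_UNIV_multiindex] countableI_type by blast
  have e_eq: "e k = e l \<longleftrightarrow> k = l" for k l
    using e by (simp add: bij_is_inj inj_eq)
  define \<phi> where "\<phi> k = monomial (e k)" for k
  define s where "s p k = solution p (e k)" for p k
  have diagonal: "diagonal_operator \<mu> \<phi> (s p)" for p
  proof
    show "(\<lambda>k. sqnorm \<mu> (s p k) / sqnorm \<mu> (\<phi> k)) \<longlonglongrightarrow> 0"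
    proof (rule LIMSEQ_I)
      fix \<epsilon> :: real assume "0 < \<epsilon>"
      from ratio[OF this, of p]
      have "finite (e -` {\<alpha>. \<epsilon> \<le> sqnorm \<mu> (solution p \<alpha>) / sqnorm \<mu> (monomial \<alpha>)})"
        using e by (intro finite_vimageI) (auto simp: bij_is_inj)
      then obtain K where "e -` {\<alpha>. \<epsilon> \<le> sqnorm \<mu> (solution p \<alpha>) / sqnorm \<mu> (monomial \<alpha>)} \<subseteq> {..<K}"
        using finite_nat_iff_bounded by blast
      then have "norm (sqnorm \<mu> (s p k) / sqnorm \<mu> (\<phi> k) - 0) < \<epsilon>" if "K \<le> k" for k
        using that by (force simp: s_def \<phi>_def not_le[symmetric])
      then show "\<exists>K. \<forall>k\<ge>K. norm (sqnorm \<mu> (s p k) / sqnorm \<mu> (\<phi> k) - 0) < \<epsilon>" by blast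
    qed
  qed (auto simp: \<phi>_def s_def monomial_L2 solution_L2 sqnorm_monomial_pos e_eq
        intro!: orthogonal solution_orthogonal)
  define D where "D p = diagonal_operator.diag \<mu> \<phi> (s p)" for p
  define coef where "coef = diagonal_operator.coef \<mu> \<phi>"
  define T where "T \<omega> = (\<lambda>z. \<Sum>p\<in>UNIV. D p (\<lambda>w. \<omega> w $ p) z)" for \<omega> :: "complex^'n \<Rightarrow> complex^'n"
  have D_L2: "D p (\<lambda>w. \<omega> w $ p) \<in> L2 \<mu>" if "\<omega> \<in> A2_01 \<mu>" for p \<omega>
    unfolding D_def using A2_01_component_L2[OF that] by (rule diagonal_operator.diag_L2[OF diagonal])
  have T_L2: "T \<omega> \<in> L2 \<mu>" if "\<omega> \<in> A2_01 \<mu>" for \<omega>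
    unfolding T_def by (intro L2_sum D_L2 that)
  have T_cong: "T \<omega> = T \<eta>" if "\<omega> \<in> A2_01 \<mu>" "\<eta> \<in> A2_01 \<mu>" "AE z in \<mu>. \<omega> z = \<eta> z" for \<omega> \<eta>
  proof -
    have "AE z in \<mu>. \<omega> z $ p = \<eta> z $ p" for p
      using that(3) by eventually_elim simp
    then have "D p (\<lambda>w. \<omega> w $ p) = D p (\<lambda>w. \<eta> w $ p)" for p
      unfolding D_def using that
      by (intro diagonal_operator.diag_cong_AE[OF diagonal] A2_01_component_L2)
    then show ?thesis by (simp add: T_def)
  qed
  have T_add: "AE z in \<mu>. T (\<lambda>w. \<omega> w + \<eta> w) z = T \<omega> z + T \<eta> z"
    if "\<omega> \<in> A2_01 \<mu>" "\<eta> \<in> A2_01 \<mu>" for \<omega> \<eta>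
  proof -
    have "AE z in \<mu>. \<forall>p\<in>UNIV. D p (\<lambda>w. \<omega> w $ p + \<eta> w $ p) z = D p (\<lambda>w. \<omega> w $ p) z + D p (\<lambda>w. \<eta> w $ p) z"
      unfolding D_def using that
      by (intro AE_finite_allI diagonal_operator.diag_add[OF diagonal] A2_01_component_L2 finite)
    then show ?thesis
      by eventually_elim (simp add: T_def sum.distrib)
  qed
  have T_scale: "AE z in \<mu>. T (\<lambda>w. b *s \<omega> w) z = b * T \<omega> z" if "\<omega> \<in> A2_01 \<mu>" for b \<omega>
  proof -
    have "AE z in \<mu>. \<forall>p\<in>UNIV. D p (\<lambda>w. b * \<omega> w $ p) z = b * D p (\<lambda>w. \<omega> w $ p) z"
      unfolding D_def using that
      by (intro AE_finite_allI diagonal_operator.diag_scale[OF diagonal] A2_01_component_L2 finite)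
    then show ?thesis
      by eventually_elim (simp add: T_def sum_distrib_left)
  qed
  have T_compact: "\<exists>f\<in>L2 \<mu>. \<exists>r. strict_mono r \<and> (\<lambda>k. L2_norm \<mu> (\<lambda>z. T (\<Omega> (r k)) z - f z)) \<longlonglongrightarrow> 0"
    if \<Omega>: "\<And>k. \<Omega> k \<in> A2_01 \<mu>" and B: "\<And>k. form_norm \<mu> (\<Omega> k) \<le> B"
    for \<Omega> :: "nat \<Rightarrow> complex^'n \<Rightarrow> complex^'n" and B
  proof -
    define c where "c m p = (\<lambda>z. \<Omega> m z $ p)" for m p
    have cL: "c m p \<in> L2 \<mu>" for m p
      unfolding c_def by (intro A2_01_component_L2 \<Omega>)
    have cB: "sqnorm \<mu> (c m p) \<le> B\<^sup>2" for m p
    proof -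
      have "sqrt (sqnorm \<mu> (c m p)) \<le> B"
        using coordinate_L2_norm_le_form_norm[of \<mu> "\<Omega> m" p] B[of m]
        by (simp add: c_def L2_norm_eq_sqrt)
      then show ?thesis
        using sqrt_le_D by blast
    qed
    \<comment> \<open>Normalised Fourier coefficients are bounded by one constant, uniformly in the index \<open>k\<close>, as the diagonal
      argument demands; the normalising factor is divided out again afterwards.\<close>
    have bound: "norm (case kp of (k, p) \<Rightarrow> coef (c m p) k * of_real (sqrt (sqnorm \<mu> (\<phi> k)))) \<le> \<bar>B\<bar>"
      for m and kp :: "nat \<times> 'n"
    proof -
      obtain k p where kp: "kp = (k, p)" by force
      have "(norm (coef (c m p) k * of_real (sqrt (sqnorm \<mu> (\<phi> k)))))\<^sup>2 \<le> \<bar>B\<bar>\<^sup>2"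
        using diagonal_operator.coef_bessel[OF diagonal cL[of m p], of "{k}"] cB[of m p]
        by (simp add: coef_def norm_mult power_mult_distrib)
      then show ?thesis
        unfolding kp by (simp add: abs_le_square_iff[symmetric] power2_le_iff_abs_le)
    qed
    obtain r where r: "strict_mono r"
      and conv: "\<And>kp. \<exists>l. (\<lambda>m. case kp of (k, p) \<Rightarrow> coef (c (r m) p) k * of_real (sqrt (sqnorm \<mu> (\<phi> k)))) \<longlonglongrightarrow> l"
      using function_convergent_subsequence[of "UNIV :: (nat \<times> 'n) set"
          "\<lambda>m kp. case kp of (k, p) \<Rightarrow> coef (c m p) k * of_real (sqrt (sqnorm \<mu> (\<phi> k)))" "\<bar>B\<bar>"]
        bound countableI_type by auto
    have coef_conv: "convergent (\<lambda>m. coef (c (r m) p) k)" for p k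
    proof -
      obtain l where "(\<lambda>m. coef (c (r m) p) k * of_real (sqrt (sqnorm \<mu> (\<phi> k)))) \<longlonglongrightarrow> l"
        using conv[of "(k, p)"] by auto
      then have "(\<lambda>m. coef (c (r m) p) k * of_real (sqrt (sqnorm \<mu> (\<phi> k))) / of_real (sqrt (sqnorm \<mu> (\<phi> k))))
          \<longlonglongrightarrow> l / of_real (sqrt (sqnorm \<mu> (\<phi> k)))"
        using sqnorm_monomial_pos[of "e k"] by (intro tendsto_divide tendsto_const) (auto simp: \<phi>_def)
      then show ?thesis
        using sqnorm_monomial_pos[of "e k"] by (auto simp: \<phi>_def convergent_def)
    qed
    have T_diff: "sqnorm \<mu> (\<lambda>z. T (\<Omega> m) z - T (\<Omega> n) z)
        \<le> CARD('n) * (\<Sum>p\<in>UNIV. sqnorm \<mu> (\<lambda>z. D p (c m p) z - D p (c n p) z))" for m n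
      unfolding T_def sum_subtractf[symmetric] c_def[symmetric]
      by (rule sqnorm_sum_le) (auto intro!: L2_diff D_L2[unfolded c_def] \<Omega> simp: c_def)
    have "\<exists>f\<in>L2 \<mu>. (\<lambda>k. sqnorm \<mu> (\<lambda>z. T (\<Omega> (r k)) z - f z)) \<longlonglongrightarrow> 0"
    proof (rule L2_complete)
      show "T (\<Omega> (r m)) \<in> L2 \<mu>" for m
        by (rule T_L2[OF \<Omega>])
    next
      fix \<epsilon> :: real assume \<epsilon>: "0 < \<epsilon>"
      \<comment> \<open>one factor \<open>n\<close> for the number of summands, one from \<open>sqnorm_sum_le\<close>\<close>
      define \<delta> where "\<delta> = \<epsilon> / (CARD('n))\<^sup>2"
      have \<delta>: "0 < \<delta>" using \<epsilon> by (simp add: \<delta>_def)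
      have "\<exists>M. \<forall>m\<ge>M. \<forall>n\<ge>M. sqnorm \<mu> (\<lambda>z. D p (c (r m) p) z - D p (c (r n) p) z) < \<delta>" for p
        unfolding D_def using coef_conv unfolding coef_def
        by (intro diagonal_operator.diag_images_Cauchy[OF diagonal cL cB _ \<delta>])
      then obtain M where M: "\<And>p m n. M p \<le> m \<Longrightarrow> M p \<le> n \<Longrightarrow>
          sqnorm \<mu> (\<lambda>z. D p (c (r m) p) z - D p (c (r n) p) z) < \<delta>"
        by metis
      have "sqnorm \<mu> (\<lambda>z. T (\<Omega> (r m)) z - T (\<Omega> (r n)) z) < \<epsilon>"
        if "Max (range M) \<le> m" "Max (range M) \<le> n" for m n
      proof -
        have "M p \<le> m" "M p \<le> n" for p
          using that by (auto intro: order_trans[OF Max_ge])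
        then have "(\<Sum>p\<in>UNIV. sqnorm \<mu> (\<lambda>z. D p (c (r m) p) z - D p (c (r n) p) z)) < (\<Sum>p\<in>(UNIV :: 'n set). \<delta>)"
          by (intro sum_strict_mono M) auto
        then have "CARD('n) * (\<Sum>p\<in>UNIV. sqnorm \<mu> (\<lambda>z. D p (c (r m) p) z - D p (c (r n) p) z))
            < CARD('n) * (\<Sum>p\<in>(UNIV :: 'n set). \<delta>)"
          by (intro mult_strict_left_mono) auto
        also have "\<dots> = \<epsilon>"
          by (simp add: \<delta>_def power2_eq_square)
        finally show ?thesis
          using T_diff[of "r m" "r n"] by linarith
      qed
      then show "\<exists>M. \<forall>m\<ge>M. \<forall>n\<ge>M. sqnorm \<mu> (\<lambda>z. T (\<Omega> (r m)) z - T (\<Omega> (r n)) z) < \<epsilon>"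
        by blast
    qed
    with r show ?thesis
      by (auto simp: L2_norm_tendsto_0_iff)
  qed
  have T_extends: "AE z in \<mu>. T \<omega> z = canonical_solution \<mu> \<omega> z" if \<omega>_poly: "\<omega> \<in> poly_forms"
    for \<omega> :: "complex^'n \<Rightarrow> complex^'n"
  proof -
    obtain a where fin: "finite {\<alpha>. a \<alpha> \<noteq> 0}" and \<omega>: "\<omega> = poly_form a"
      using \<omega>_poly unfolding poly_forms_def by blast
    have L: "(\<lambda>z. \<omega> z $ p) \<in> L2 \<mu>" for p
      unfolding \<omega> by (intro A2_01_component_L2 poly_form_A2_01 fin)
    have coef: "coef (\<lambda>z. \<omega> z $ p) k = a (e k) $ p" for p k
      using sqnorm_monomial_pos[of "e k"]
      by (simp add: coef_def diagonal_operator.coef_def[OF diagonal] \<omega> \<phi>_def inner_poly_form_monomial[OF fin])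
    define F where "F = e -` {\<alpha>. a \<alpha> \<noteq> 0}"
    have F: "finite F"
      unfolding F_def using e fin by (intro finite_vimageI) (auto simp: bij_is_inj)
    have "AE z in \<mu>. \<forall>p\<in>UNIV. D p (\<lambda>z. \<omega> z $ p) z = (\<Sum>k\<in>F. coef (\<lambda>z. \<omega> z $ p) k * s p k z)"
      unfolding D_def coef_def
      by (intro AE_finite_allI diagonal_operator.diag_eq_finite_sum[OF diagonal] L F finite)
         (simp add: coef[unfolded coef_def] F_def)
    then show ?thesis
      using canonical_solution_poly_form_AE[OF fin]
    proof eventually_elim
      case (elim z)
      have bij: "bij_betw e F {\<alpha>. a \<alpha> \<noteq> 0}"
        unfolding F_def using e by (auto simp: bij_betw_def bij_is_inj inj_on_def e_eq bij_is_surj surj_image_vimage_eq)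
      have "T \<omega> z = (\<Sum>p\<in>UNIV. \<Sum>k\<in>F. a (e k) $ p * solution p (e k) z)"
        using elim by (simp add: T_def coef s_def)
      also have "\<dots> = (\<Sum>p\<in>UNIV. \<Sum>\<alpha> | a \<alpha> \<noteq> 0. a \<alpha> $ p * solution p \<alpha> z)"
        by (intro sum.cong refl sum.reindex_bij_betw[OF bij])
      also have "\<dots> = canonical_solution \<mu> \<omega> z"
        using elim unfolding \<omega> by (subst sum.swap) simp
      finally show ?case .
    qed
  qed
  have "compact_operator_A2_01_L2 \<mu> T"
    unfolding compact_operator_A2_01_L2_def
  proof (intro conjI ballI allI impI)
    fix \<omega> \<eta> :: "complex^'n \<Rightarrow> complex^'n"
    assume "\<omega> \<in> A2_01 \<mu>" "\<eta> \<in> A2_01 \<mu>" "AE z in \<mu>. \<omega> z = \<eta> z"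
    then have "T \<omega> = T \<eta>"
      by (rule T_cong)
    then show "AE z in \<mu>. T \<omega> z = T \<eta> z"
      by simp
  next
    fix \<Omega> :: "nat \<Rightarrow> complex^'n \<Rightarrow> complex^'n"
    assume "(\<forall>k. \<Omega> k \<in> A2_01 \<mu>) \<and> (\<exists>B. \<forall>k. form_norm \<mu> (\<Omega> k) \<le> B)"
    then show "\<exists>f\<in>L2 \<mu>. \<exists>r. strict_mono r \<and> (\<lambda>k. L2_norm \<mu> (\<lambda>z. T (\<Omega> (r k)) z - f z)) \<longlonglongrightarrow> 0"
      using T_compact by blast
  qed (rule T_L2 T_add T_scale; assumption)+
  with T_extends show ?thesis
    unfolding canonical_solution_operator_compact_def by blast
qed

end

theorem theorem2:
  fixes \<mu> :: "(complex^'n) measure"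
  assumes borel: "sets \<mu> = sets borel"
    and orthogonal: "\<And>\<alpha> \<beta>. \<alpha> \<noteq> \<beta> \<Longrightarrow> L2_inner \<mu> (monomial \<alpha>) (monomial \<beta>) = 0"
    and finite_norm: "\<And>\<alpha>. integrable \<mu> (\<lambda>z. (cmod (monomial \<alpha> z))\<^sup>2)"
    and pos_norm: "\<And>\<alpha>. 0 < (LINT z|\<mu>. (cmod (monomial \<alpha> z))\<^sup>2)"
  shows "canonical_solution_operator_compact \<mu> \<longleftrightarrow>
    (\<forall>p. ((\<lambda>\<gamma>. c_coeff \<mu> (\<gamma> + axis p 1) / c_coeff \<mu> (\<gamma> + axis p 2)
              - c_coeff \<mu> \<gamma> / c_coeff \<mu> (\<gamma> + axis p 1)) \<longlongrightarrow> 0)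
          (inf cofinite (principal {\<gamma> \<in> multiindices. \<forall>i. (\<gamma> + axis p 1) $ i \<ge> 0})))"
proof -
  interpret orthogonal_monomials \<mu>
    by standard (fact borel orthogonal finite_norm pos_norm)+
  show ?thesis
    unfolding tendsto_c_coeff_iff
    using canonical_solution_compact_imp_ratio ratio_imp_canonical_solution_compact by blast
qed

end
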